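(* Let $p$ be an odd prime, let $G$ be a finite $p$-group and let $N$ be a normal subgroup of $G$. If $N$ is powerful, then $\exp(N\wedge G)$ divides $\exp(N)$.
   Context: For odd $p$, a finite $p$-group $N$ is powerful if $[N,N]\subseteq N^p$, where $N^p$ is the subgroup generated by $p$-th powers. Conventions: ${}^g h = ghg^{-1}$, $[g,h]=ghg^{-1}h^{-1}$. For $N\trianglelefteq G$, the nonabelian tensor product $N\otimes G$ (with actions by conjugation) is the group generated by symbols $n\otimes g$ ($n\in N$, $g\in G$) subject to $nn'\otimes g=({}^n n'\otimes {}^n g)(n\otimes g)$ and $n\otimes gg'=(n\otimes g)({}^g n\otimes {}^g g')$; the exterior product $N\wedge G$ is its quotient by the subgroup generated by all $x\otimes x$, $x\in N$. *)

theory Defs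
  imports "HOL-Algebra.Algebra"
begin

definition conjg :: "('a, 'b) monoid_scheme \<Rightarrow> 'a \<Rightarrow> 'a \<Rightarrow> 'a" where
  "conjg G g h = g \<otimes>\<^bsub>G\<^esub> h \<otimes>\<^bsub>G\<^esub> inv\<^bsub>G\<^esub> g"

definition p_group :: "nat \<Rightarrow> ('a, 'b) monoid_scheme \<Rightarrow> bool" where
  "p_group p G \<longleftrightarrow> group G \<and> finite (carrier G) \<and> (\<exists>k. card (carrier G) = p ^ k)"

definition pth_powers :: "('a, 'b) monoid_scheme \<Rightarrow> nat \<Rightarrow> 'a set \<Rightarrow> 'a set" where
  "pth_powers G p N = generate G {x [^]\<^bsub>G\<^esub> p | x. x \<in> N}"

text \<open>Powerful (odd p): [N,N] \<subseteq> N^p. The library's derived G N is generated by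
  commutators h1 h2 h1^-1 h2^-1, matching the paper's convention.\<close>
definition powerful :: "('a, 'b) monoid_scheme \<Rightarrow> nat \<Rightarrow> 'a set \<Rightarrow> bool" where
  "powerful G p N \<longleftrightarrow> derived G N \<subseteq> pth_powers G p N"

definition group_exp :: "('a, 'b) monoid_scheme \<Rightarrow> nat" where
  "group_exp G = (if \<exists>m::nat>0. \<forall>x\<in>carrier G. x [^]\<^bsub>G\<^esub> m = \<one>\<^bsub>G\<^esub>
      then (LEAST m::nat. m > 0 \<and> (\<forall>x\<in>carrier G. x [^]\<^bsub>G\<^esub> m = \<one>\<^bsub>G\<^esub>)) else 0)"

text \<open>Nonabelian exterior product N \<wedge> G as a presented group.
  Words are lists of letters ((n,g), b) with n \<in> N, g \<in> G; b = True stands for the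
  generator n\<wedge>g, b = False for its inverse. ext_rel is the congruence on words generated by
  free cancellation and the defining relations.\<close>
definition ext_letters :: "('a, 'b) monoid_scheme \<Rightarrow> 'a set \<Rightarrow> (('a \<times> 'a) \<times> bool) set" where
  "ext_letters G N = {((n, g), b). n \<in> N \<and> g \<in> carrier G}"

definition ext_words :: "('a, 'b) monoid_scheme \<Rightarrow> 'a set \<Rightarrow> (('a \<times> 'a) \<times> bool) list set" where
  "ext_words G N = {w. set w \<subseteq> ext_letters G N}"

inductive ext_rel :: "('a, 'b) monoid_scheme \<Rightarrow> 'a set
    \<Rightarrow> (('a \<times> 'a) \<times> bool) list \<Rightarrow> (('a \<times> 'a) \<times> bool) list \<Rightarrow> bool"
  for G N where
  refl: "w \<in> ext_words G N \<Longrightarrow> ext_rel G N w w"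
| sym: "ext_rel G N u v \<Longrightarrow> ext_rel G N v u"
| trans: "ext_rel G N u v \<Longrightarrow> ext_rel G N v w \<Longrightarrow> ext_rel G N u w"
| ctx: "ext_rel G N u v \<Longrightarrow> a \<in> ext_words G N \<Longrightarrow> c \<in> ext_words G N
          \<Longrightarrow> ext_rel G N (a @ u @ c) (a @ v @ c)"
| cancel: "n \<in> N \<Longrightarrow> g \<in> carrier G \<Longrightarrow> ext_rel G N [((n, g), b), ((n, g), \<not> b)] []"
| rel_left: "n \<in> N \<Longrightarrow> n' \<in> N \<Longrightarrow> g \<in> carrier G \<Longrightarrow>
     ext_rel G N [((n \<otimes>\<^bsub>G\<^esub> n', g), True)]
                 [((conjg G n n', conjg G n g), True), ((n, g), True)]"
| rel_right: "n \<in> N \<Longrightarrow> g \<in> carrier G \<Longrightarrow> g' \<in> carrier G \<Longrightarrow>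
     ext_rel G N [((n, g \<otimes>\<^bsub>G\<^esub> g'), True)]
                 [((n, g), True), ((conjg G g n, conjg G g g'), True)]"
| rel_diag: "x \<in> N \<Longrightarrow> ext_rel G N [((x, x), True)] []"

definition exterior_product :: "('a, 'b) monoid_scheme \<Rightarrow> 'a set
    \<Rightarrow> (('a \<times> 'a) \<times> bool) list set monoid" where
  "exterior_product G N =
     \<lparr> carrier = {{v. ext_rel G N u v} | u. u \<in> ext_words G N},
       Group.monoid.mult = (\<lambda>A B. {w. \<exists>u\<in>A. \<exists>v\<in>B. ext_rel G N (u @ v) w}),
       one = {v. ext_rel G N [] v} \<rparr>"

end

theory Submission
  imports Defs
begin

text \<open>
  Let \<open>P\<^sub>0 = N\<close> and \<open>P\<^sub>i\<^sub>+\<^sub>1 = P\<^sub>i\<^sup>p\<close>. If \<open>N\<close> is powerful then \<open>[N, P\<^sub>i] \<subseteq> P\<^sub>i\<^sub>+\<^sub>1\<close>, and \<open>P\<^sub>i\<close> is generated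
  by the \<open>p\<^sup>i\<close>-th powers of elements of \<open>N\<close>; hence \<open>P\<^sub>e = 1\<close> when \<open>exp N = p\<^sup>e\<close>. Both facts
  follow by nilpotency from calculations in quotients where the relevant commutators are central.

  Let \<open>K\<^sub>i\<close> be the normal subgroup of \<open>N \<and> G\<close> generated by the \<open>m \<and> g\<close> with \<open>m \<in> P\<^sub>i\<close>. Modulo
  \<open>K\<^sub>i\<^sub>+\<^sub>1\<close> the commutators \<open>[b \<and> h, a \<and> q] = [b, h] \<and> [a, q]\<close> of generators of \<open>K\<^sub>i\<close> are central, and
  expanding \<open>a\<^sup>n \<and> q = (a \<and> [a, q])\<^bsup>n(n-1)/2\<^esup> (a \<and> q)\<^sup>n\<close> at \<open>n = p\<close> shows that the generators have
  order dividing \<open>p\<close>. As \<open>p\<close> is odd, \<open>K\<^sub>i/K\<^sub>i\<^sub>+\<^sub>1\<close> has exponent dividing \<open>p\<close>, so \<open>p\<^sup>e\<close>-th powers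
  in \<open>N \<and> G = K\<^sub>0\<close> lie in \<open>K\<^sub>e = 1\<close>.
\<close>

section \<open>Elements generating a group of class two\<close>

context group begin

text \<open>Each of the \<open>n\<close> factors \<open>y\<close> that is moved past
  \<open>x\<close> leaves one factor \<open>z\<close>, and \<open>zy\<close> lets these collect on
  the left.\<close>

lemma pow_commutator:
  assumes [simp]: "x \<in> carrier G" "y \<in> carrier G" "z \<in> carrier G"
    and yx: "y \<otimes> x = z \<otimes> (x \<otimes> y)" and zy: "z \<otimes> y = y \<otimes> z"
  shows "y [^] (n::nat) \<otimes> x = z [^] n \<otimes> (x \<otimes> y [^] n)"
proof (induction n)
  case 0
  then show ?case by simp
next
  case (Suc n)
  have "y [^] Suc n \<otimes> x = y [^] n \<otimes> (y \<otimes> x)" by (simp add: m_assoc)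
  also have "\<dots> = (y [^] n \<otimes> z) \<otimes> (x \<otimes> y)" by (simp add: yx m_assoc)
  also have "\<dots> = z \<otimes> (y [^] n \<otimes> x) \<otimes> y"
    using group_commutes_pow[of y z n] zy by (simp add: m_assoc)
  also have "\<dots> = (z \<otimes> z [^] n) \<otimes> (x \<otimes> (y [^] n \<otimes> y))" by (simp add: Suc m_assoc)
  also have "\<dots> = z [^] Suc n \<otimes> (x \<otimes> y [^] Suc n)" by (metis assms(3) nat_pow_Suc nat_pow_Suc2)
  finally show ?case .
qed

lemma commutator_pow:
  assumes [simp]: "x \<in> carrier G" "y \<in> carrier G" "z \<in> carrier G"
    and yx: "y \<otimes> x = z \<otimes> (x \<otimes> y)" and zx: "z \<otimes> x = x \<otimes> z"
  shows "y \<otimes> x [^] (n::nat) = z [^] n \<otimes> (x [^] n \<otimes> y)"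
proof (induction n)
  case 0
  then show ?case by simp
next
  case (Suc n)
  have "y \<otimes> x [^] Suc n = (y \<otimes> x [^] n) \<otimes> x" by (simp add: m_assoc)
  also have "\<dots> = z [^] n \<otimes> (x [^] n \<otimes> (y \<otimes> x))" by (simp add: Suc m_assoc)
  also have "\<dots> = z [^] n \<otimes> ((x [^] n \<otimes> z) \<otimes> (x \<otimes> y))" by (simp add: yx m_assoc)
  also have "x [^] n \<otimes> z = z \<otimes> x [^] n" using group_commutes_pow[of x z n] zx by simp
  also have "z [^] n \<otimes> (z \<otimes> x [^] n \<otimes> (x \<otimes> y)) = z [^] Suc n \<otimes> (x [^] Suc n \<otimes> y)"
    by (simp add: m_assoc)
  finally show ?case .
qed

text \<open>In the induction step the new \<open>x\<close> is moved to the left past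
  \<open>y [^] n\<close>, which costs \<open>z [^] n\<close>. The costs 0 + 1 + ... + (n - 1) add up
  to \<open>n choose 2\<close>.\<close>

lemma pow_mult_class2:
  assumes [simp]: "x \<in> carrier G" "y \<in> carrier G" "z \<in> carrier G"
    and yx: "y \<otimes> x = z \<otimes> (x \<otimes> y)" and zx: "z \<otimes> x = x \<otimes> z" and zy: "z \<otimes> y = y \<otimes> z"
  shows "(x \<otimes> y) [^] (n::nat) = z [^] (n choose 2) \<otimes> (x [^] n \<otimes> y [^] n)"
proof (induction n)
  case 0
  then show ?case by (simp add: numeral_2_eq_2)
next
  case (Suc n)
  have c: "Suc n choose 2 = (n choose 2) + n" by (simp add: numeral_2_eq_2)
  have xz: "x [^] n \<otimes> z [^] n = z [^] n \<otimes> x [^] n"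
    using group_commutes_pow[of x "z [^] n" n] group_commutes_pow[of z x n] zx by simp
  have "(x \<otimes> y) [^] Suc n = z [^] (n choose 2) \<otimes> (x [^] n \<otimes> ((y [^] n \<otimes> x) \<otimes> y))"
    by (simp add: Suc m_assoc)
  also have "\<dots> = z [^] (n choose 2) \<otimes> ((x [^] n \<otimes> z [^] n) \<otimes> (x \<otimes> (y [^] n \<otimes> y)))"
    using pow_commutator[OF assms(1-3) yx zy] by (simp add: m_assoc)
  also have "\<dots> = (z [^] (n choose 2) \<otimes> z [^] n) \<otimes> (x [^] Suc n \<otimes> y [^] Suc n)"
    by (simp add: xz m_assoc)
  finally show ?case by (simp add: c nat_pow_mult)
qed

text \<open>For odd \<open>p\<close> the number \<open>p choose 2\<close> is a multiple of
  \<open>p\<close>, so the correction term of \<open>pow_mult_class2\<close> vanishes.\<close>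

lemma pow_prime_mult_class2:
  assumes "x \<in> carrier G" "y \<in> carrier G" "z \<in> carrier G"
    and "y \<otimes> x = z \<otimes> (x \<otimes> y)" "z \<otimes> x = x \<otimes> z" "z \<otimes> y = y \<otimes> z"
    and "odd (p::nat)" and "z [^] p = \<one>"
  shows "(x \<otimes> y) [^] p = x [^] p \<otimes> y [^] p"
proof -
  obtain k where p: "p = 2 * k + 1" using \<open>odd p\<close> by (elim oddE)
  have "p choose 2 = p * k" by (simp add: p choose_two)
  then have "z [^] (p choose 2) = \<one>"
    using assms(3,8) by (metis nat_pow_one nat_pow_pow)
  then show ?thesis using pow_mult_class2[OF assms(1-6)] assms(1,2) by simp
qed

text \<open>The commutator \<open>d\<close> of \<open>x\<close> and \<open>c = [g, x]\<close> has order dividing that of \<open>c\<close>.\<close>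
lemma conj_pow_eq:
  assumes [simp]: "x \<in> carrier G" "g \<in> carrier G" "c \<in> carrier G" "d \<in> carrier G"
    and gx: "g \<otimes> x = c \<otimes> (x \<otimes> g)" and xc: "x \<otimes> c = d \<otimes> (c \<otimes> x)"
    and dx: "d \<otimes> x = x \<otimes> d" and dc: "d \<otimes> c = c \<otimes> d"
    and "odd (p::nat)" and cp: "c [^] p = \<one>"
  shows "g \<otimes> x [^] p = x [^] p \<otimes> g"
proof -
  have "x \<otimes> c [^] p = d [^] p \<otimes> (c [^] p \<otimes> x)"
    by (rule commutator_pow[OF assms(3,1,4) xc dc])
  then have dp: "d [^] p = \<one>" using cp by simp
  \<comment> \<open>Conjugation by \<open>g\<close> carries \<open>x\<close> to
    \<open>c \<otimes> x\<close>, so this equation means that it fixes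
    \<open>x [^] p\<close>.\<close>
  have cx: "(c \<otimes> x) [^] p = x [^] p"
    using pow_prime_mult_class2[OF assms(3,1,4) xc dc dx \<open>odd p\<close> dp] cp by simp
  have "g \<otimes> x [^] n = (c \<otimes> x) [^] n \<otimes> g" for n :: nat
  proof (induction n)
    case 0
    then show ?case by simp
  next
    case (Suc n)
    have "g \<otimes> x [^] Suc n = (g \<otimes> x [^] n) \<otimes> x" by (simp add: m_assoc)
    also have "\<dots> = (c \<otimes> x) [^] n \<otimes> (g \<otimes> x)" by (simp add: Suc m_assoc)
    finally show ?case by (simp add: gx m_assoc)
  qed
  then show ?thesis by (simp add: cx)
qed

lemma commute_inv:
  assumes [simp]: "g \<in> carrier G" "x \<in> carrier G" and gx: "g \<otimes> x = x \<otimes> g"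
  shows "g \<otimes> inv x = inv x \<otimes> g"
proof -
  have "g \<otimes> inv x = inv x \<otimes> (x \<otimes> g) \<otimes> inv x" by (simp add: m_assoc[symmetric])
  also have "\<dots> = inv x \<otimes> g" by (simp add: gx[symmetric] m_assoc)
  finally show ?thesis .
qed

lemma commute_mult:
  assumes [simp]: "g \<in> carrier G" "x \<in> carrier G" "y \<in> carrier G"
    and gx: "g \<otimes> x = x \<otimes> g" and gy: "g \<otimes> y = y \<otimes> g"
  shows "g \<otimes> (x \<otimes> y) = x \<otimes> y \<otimes> g"
  using gx gy by (metis assms(1-3) m_assoc)

lemma commute_generate:
  assumes S: "S \<subseteq> carrier G" and z: "z \<in> carrier G"
    and c: "\<And>s. s \<in> S \<Longrightarrow> z \<otimes> s = s \<otimes> z" and y: "y \<in> generate G S"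
  shows "z \<otimes> y = y \<otimes> z"
  using y
proof (induction rule: generate.induct)
  case (inv h)
  then show ?case using S z c[OF inv] by (intro commute_inv) auto
next
  case (eng h1 h2)
  then show ?case using z generate_in_carrier[OF S] by (intro commute_mult) auto
qed (simp_all add: c z)

text \<open>Commutators of generators are central, so the generated group has class at most two and
  \<open>pow_prime_mult_class2\<close> makes the \<open>p\<close>-th power multiplicative on it. The
  work lies in passing from commutators of generators to those of arbitrary elements.\<close>

lemma pow_generate_class2:
  assumes S: "S \<subseteq> carrier G" and "odd (p::nat)"
    and pw: "\<And>s. s \<in> S \<Longrightarrow> s [^] p = \<one>"
    and comm: "\<And>s t. s \<in> S \<Longrightarrow> t \<in> S \<Longrightarrow>
      \<exists>z\<in>carrier G. s \<otimes> t = z \<otimes> (t \<otimes> s) \<and> (\<forall>u\<in>S. z \<otimes> u = u \<otimes> z)"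
    and x: "x \<in> generate G S"
  shows "x [^] p = \<one>"
proof -
  have carr: "y \<in> carrier G" if "y \<in> generate G S" for y
    using generate_in_carrier[OF S that] .
  \<comment> \<open>\<open>Z\<close> is the modulus of the argument: it is a subgroup, and all
    commutators will be shown to lie in it.\<close>
  define Z where "Z = {z \<in> generate G S. z [^] p = \<one> \<and> (\<forall>y\<in>generate G S. z \<otimes> y = y \<otimes> z)}"
  have Zc': "z \<otimes> y = y \<otimes> z" if "z \<in> Z" "y \<in> generate G S" for z y
    using that by (simp add: Z_def)
  have Zp: "z [^] p = \<one>" if "z \<in> Z" for z using that by (simp add: Z_def)
  have Zg: "z \<in> generate G S" if "z \<in> Z" for z using that by (simp add: Z_def)
  have ZI: "z \<in> Z" if "z \<in> generate G S" "z [^] p = \<one>"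
    "\<And>y. y \<in> generate G S \<Longrightarrow> z \<otimes> y = y \<otimes> z" for z
    unfolding Z_def using that by blast
  have Z: "subgroup Z G"
  proof (rule subgroupI)
    show "Z \<subseteq> carrier G" using carr Zg by blast
    have "\<one> \<in> Z" by (rule ZI) (simp_all add: generate.one carr)
    then show "Z \<noteq> {}" by blast
  next
    fix z assume z: "z \<in> Z"
    then have [simp]: "z \<in> carrier G" using carr Zg by blast
    have "inv z \<otimes> y = y \<otimes> inv z" if "y \<in> generate G S" for y
    proof -
      have "y \<otimes> inv z = inv z \<otimes> (z \<otimes> y) \<otimes> inv z" using carr[OF that] by (simp add: m_assoc[symmetric])
      then show ?thesis using Zc'[OF z that] carr[OF that] by (simp add: m_assoc)
    qed
    then show "inv z \<in> Z"
      using nat_pow_inv[of z p] Zp[OF z] generate_m_inv_closed[OF S Zg[OF z]] by (intro ZI) auto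
  next
    fix z1 z2 assume z: "z1 \<in> Z" "z2 \<in> Z"
    then have [simp]: "z1 \<in> carrier G" "z2 \<in> carrier G" using carr Zg by blast+
    have "(z1 \<otimes> z2) [^] p = z1 [^] p \<otimes> z2 [^] p"
      using Zc'[OF z(1) Zg[OF z(2)]] by (intro pow_mult_distrib) auto
    moreover have "z1 \<otimes> z2 \<otimes> y = y \<otimes> (z1 \<otimes> z2)" if y: "y \<in> generate G S" for y
      using Zc'[OF z(1) y] Zc'[OF z(2) y] carr[OF y]
      by (metis \<open>z1 \<in> carrier G\<close> \<open>z2 \<in> carrier G\<close> m_assoc)
    ultimately show "z1 \<otimes> z2 \<in> Z"
      using Zp[OF z(1)] Zp[OF z(2)] generate.eng[OF Zg[OF z(1)] Zg[OF z(2)]] by (intro ZI) auto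
  qed
  note [simp] = subgroup.mem_carrier[OF Z]
  have commZ: "\<exists>z\<in>Z. s \<otimes> t = z \<otimes> (t \<otimes> s)" if st: "s \<in> S" "t \<in> S" for s t
  proof -
    obtain z where z [simp]: "z \<in> carrier G" and eq: "s \<otimes> t = z \<otimes> (t \<otimes> s)"
      and zc: "\<And>u. u \<in> S \<Longrightarrow> z \<otimes> u = u \<otimes> z" using comm[OF st] by auto
    have [simp]: "s \<in> carrier G" "t \<in> carrier G" using st S by auto
    \<comment> \<open>Since \<open>t [^] p\<close> is trivial it commutes with \<open>s\<close>,
      which forces \<open>z [^] p = \<one>\<close>.\<close>
    have "s \<otimes> t [^] p = z [^] p \<otimes> (t [^] p \<otimes> s)"
      using zc st eq by (intro commutator_pow) auto
    then have "z [^] p = \<one>" using pw st by simp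
    moreover have "z = (s \<otimes> t) \<otimes> (inv s \<otimes> inv t)"
      unfolding eq by (simp add: m_assoc inv_mult_group[symmetric])
    then have "z \<in> generate G S"
      using st by (auto intro: generate.intros)
    ultimately have "z \<in> Z"
      using commute_generate[OF S z zc] by (intro ZI) auto
    then show ?thesis using eq by blast
  qed
  \<comment> \<open>For fixed \<open>t\<close>, having commutator with \<open>t\<close> in
    \<open>Z\<close> passes from generators to products and inverses. \<open>R'\<close> uses this
    twice: first against a generator, then, after inverting \<open>z\<close> to exchange the two
    sides, against an arbitrary element.\<close>
  have R: "\<exists>z\<in>Z. y \<otimes> t = z \<otimes> (t \<otimes> y)"
    if t: "t \<in> generate G S" and st: "\<And>s. s \<in> S \<Longrightarrow> \<exists>z\<in>Z. s \<otimes> t = z \<otimes> (t \<otimes> s)"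
      and y: "y \<in> generate G S" for t y
    using y
  proof (induction rule: generate.induct)
    case one
    then show ?case using subgroup.one_closed[OF Z] carr[OF t] by force
  next
    case (incl h)
    then show ?case using st by simp
  next
    case (inv h)
    obtain z where z: "z \<in> Z" "h \<otimes> t = z \<otimes> (t \<otimes> h)" using st[OF inv] by auto
    have [simp]: "h \<in> carrier G" "t \<in> carrier G" using S inv carr[OF t] by auto
    have zh: "inv h \<otimes> z = z \<otimes> inv h" using Zc'[OF z(1) generate.inv[OF inv]] by simp
    have "t \<otimes> inv h = inv h \<otimes> (h \<otimes> t) \<otimes> inv h" by (simp add: m_assoc[symmetric])
    also have "\<dots> = inv h \<otimes> z \<otimes> t" using z by (simp add: m_assoc)
    also have "\<dots> = z \<otimes> (inv h \<otimes> t)" using z(1) by (simp add: zh m_assoc)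
    finally have "inv h \<otimes> t = inv z \<otimes> (t \<otimes> inv h)" using z(1) by (simp add: m_assoc[symmetric])
    then show ?case using subgroup.m_inv_closed[OF Z z(1)] by blast
  next
    case (eng h1 h2)
    obtain z1 z2 where z: "z1 \<in> Z" "h1 \<otimes> t = z1 \<otimes> (t \<otimes> h1)" "z2 \<in> Z" "h2 \<otimes> t = z2 \<otimes> (t \<otimes> h2)"
      using eng by auto
    have [simp]: "h1 \<in> carrier G" "h2 \<in> carrier G" "t \<in> carrier G" using carr eng t by auto
    have "h1 \<otimes> h2 \<otimes> t = (h1 \<otimes> z2) \<otimes> (t \<otimes> h2)" using z by (simp add: m_assoc)
    also have "h1 \<otimes> z2 = z2 \<otimes> h1" using Zc'[OF z(3) eng(1)] by simp
    also have "z2 \<otimes> h1 \<otimes> (t \<otimes> h2) = z2 \<otimes> (h1 \<otimes> t) \<otimes> h2" using z(3) by (simp add: m_assoc)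
    also have "\<dots> = (z2 \<otimes> z1) \<otimes> (t \<otimes> (h1 \<otimes> h2))" using z by (simp add: m_assoc)
    finally show ?case using subgroup.m_closed[OF Z z(3,1)] by blast
  qed
  have R': "\<exists>z\<in>Z. y \<otimes> t = z \<otimes> (t \<otimes> y)" if t: "t \<in> generate G S" and y: "y \<in> generate G S" for t y
  proof (rule R[OF t _ y])
    fix s assume s: "s \<in> S"
    have "\<exists>z\<in>Z. t \<otimes> s = z \<otimes> (s \<otimes> t)"
      by (rule R[OF _ commZ t]) (use s generate.incl in auto)
    then obtain z where z: "z \<in> Z" "t \<otimes> s = z \<otimes> (s \<otimes> t)" by auto
    then have "s \<otimes> t = inv z \<otimes> (t \<otimes> s)"
      using s S carr[OF t] by (simp add: m_assoc[symmetric] subset_iff)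
    then show "\<exists>z\<in>Z. s \<otimes> t = z \<otimes> (t \<otimes> s)" using subgroup.m_inv_closed[OF Z z(1)] by blast
  qed
  show ?thesis
    using x
  proof (induction rule: generate.induct)
    case (inv h)
    then show ?case using pw[OF inv] S nat_pow_inv[of h p] by auto
  next
    case (eng h1 h2)
    obtain z where z: "z \<in> Z" "h2 \<otimes> h1 = z \<otimes> (h1 \<otimes> h2)" using R'[OF eng(1,2)] by auto
    show ?case
      using pow_prime_mult_class2[of h1 h2 z p] z eng Zc' Zp carr \<open>odd p\<close> by simp
  qed (simp_all add: pw)
qed

end

section \<open>Normal subgroups of finite p-groups\<close>

text \<open>Orbit counting under conjugation on \<open>A - {\<one>}\<close>. Without a nontrivial
  central element in \<open>A\<close>, every orbit has size divisible by \<open>p\<close>, so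
  \<open>p\<close> divides both \<open>card A - 1\<close> and \<open>card A\<close>.\<close>

lemma (in group) normal_meets_center:
  assumes p: "Factorial_Ring.prime (p::nat)" and ord: "order G dvd p ^ k"
    and A: "A \<lhd> G" and nontriv: "A \<noteq> {\<one>}"
  obtains a where "a \<in> A" "a \<noteq> \<one>" "\<And>g. g \<in> carrier G \<Longrightarrow> g \<otimes> a = a \<otimes> g"
proof (rule ccontr)
  assume contra: "\<not> thesis"
  \<comment> \<open>The elimination rule of the goal gets a second name because later
    \<open>if\<close> clauses rebind \<open>that\<close>.\<close>
  note found = that
  interpret A: normal A G by (rule A)
  define \<phi> where "\<phi> = (\<lambda>g. \<lambda>h \<in> carrier G. g \<otimes> h \<otimes> inv g)"
  interpret group_action G "carrier G" \<phi> unfolding \<phi>_def by (rule action_by_conjugation)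
  have "order G \<noteq> 0" using ord p by (metis dvd_0_left_iff not_prime_0 power_eq_0_iff)
  then have fin: "finite (carrier G)" using order_gt_0_iff_finite by blast
  then have finA: "finite A" using A.subset finite_subset by blast
  have dvd_p: "p dvd m" if "m dvd order G" "m \<noteq> 1" for m
    using that ord p by (metis divides_primepow_nat dvd_power dvd_trans power_0 gr0I)
  define B where "B = A - {\<one>}"
  define r where "r = {(x, y). x \<in> B \<and> y \<in> B \<and> y \<in> orbit G \<phi> x}"
  have orbB: "orbit G \<phi> x \<subseteq> B" if x: "x \<in> B" for x
  proof
    fix y assume "y \<in> orbit G \<phi> x"
    then obtain g where g: "g \<in> carrier G" "y = g \<otimes> x \<otimes> inv g"
      using x A.subset by (auto simp: orbit_def \<phi>_def B_def)
    have xc: "x \<in> carrier G" using x by (auto simp: B_def)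
    have "x = \<one>" if "y = \<one>"
    proof -
      have "x = inv g \<otimes> y \<otimes> g" using g xc by (simp add: m_assoc) (simp add: m_assoc[symmetric])
      then show ?thesis using that g by simp
    qed
    then show "y \<in> B" using g x A.inv_op_closed2 by (auto simp: B_def)
  qed
  have Bc: "x \<in> carrier G" if "x \<in> B" for x using that by (auto simp: B_def)
  have "equiv B r"
  proof (rule equivI)
    show "r \<subseteq> B \<times> B" by (auto simp: r_def)
    show "refl_on B r" by (auto simp: refl_on_def r_def Bc orbit_refl)
    show "sym r" by (auto simp: sym_def r_def Bc intro: orbit_sym)
    show "trans r" unfolding trans_def r_def by (auto intro: orbit_trans Bc)
  qed
  moreover have "p dvd card Y" if Y: "Y \<in> B // r" for Y
  proof -
    obtain x where x: "x \<in> B" "Y = r `` {x}" using Y unfolding quotient_def by blast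
    then have Yo: "Y = orbit G \<phi> x" using orbB by (auto simp: r_def)
    \<comment> \<open>An orbit with a single point would make \<open>x\<close> central, contrary to
      the assumption.\<close>
    have "Y \<noteq> {x}"
    proof
      assume X1: "Y = {x}"
      have "g \<otimes> x = x \<otimes> g" if g: "g \<in> carrier G" for g
      proof -
        have "g \<otimes> x \<otimes> inv g \<in> Y" unfolding Yo orbit_def using g Bc[OF x(1)] by (force simp: \<phi>_def)
        then show ?thesis using X1 g Bc[OF x(1)] by (metis inv_solve_right' m_closed singletonD)
      qed
      then have thesis using x(1) by (intro found[of x]) (auto simp: B_def)
      then show False using contra by simp
    qed
    moreover have "x \<in> Y" using Yo orbit_refl Bc x by auto
    ultimately have "card Y \<noteq> 1" by (metis card_1_singletonE singletonD)
    moreover have "card Y dvd order G"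
      using orbit_stabilizer_theorem[OF Bc[OF x(1)]] Yo by (metis dvd_triv_left)
    ultimately show ?thesis using dvd_p by blast
  qed
  ultimately have "p dvd card B" using equiv_imp_dvd_card finA by (metis B_def finite_Diff)
  moreover have "p dvd card A"
  proof (rule dvd_p)
    show "card A dvd order G" using lagrange[OF A.subgroup_axioms] by (metis dvd_triv_right)
    show "card A \<noteq> 1" using nontriv A.one_closed by (metis card_1_singletonE singletonD)
  qed
  moreover have "card A = Suc (card B)"
    unfolding B_def using finA A.one_closed by (rule card.remove)
  ultimately have "p dvd 1" using dvd_diff_nat[of p "card A" "card B"] by simp
  then show False using p by simp
qed

text \<open>Presents the factor group as an abstract surjection with kernel \<open>C\<close>, so
  that later calculations deal with images of elements and not with cosets.\<close>

lemma (in group) quotient_hom: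
  assumes "C \<lhd> G"
  obtains Q :: "'a set monoid" and h where "group_hom G Q h" "h ` carrier G = carrier Q"
    "\<And>x. x \<in> carrier G \<Longrightarrow> h x = \<one>\<^bsub>Q\<^esub> \<longleftrightarrow> x \<in> C" "order Q dvd order G"
proof (rule that[of "G Mod C" "(#>) C"])
  interpret normal C G by (rule assms)
  show "group_hom G (G Mod C) ((#>) C)"
    by (simp add: group_hom_def group_hom_axioms_def factorgroup_is_group is_group r_coset_hom_Mod)
  show "(#>) C ` carrier G = carrier (G Mod C)" by (simp add: carrier_FactGroup)
  show "C #> x = \<one>\<^bsub>G Mod C\<^esub> \<longleftrightarrow> x \<in> C" if "x \<in> carrier G" for x
    using that coset_join1[OF _ that subgroup_axioms] coset_join2[OF that subgroup_axioms]
    unfolding one_FactGroup by fast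
  show "order (G Mod C) dvd order G"
  proof -
    have "order (G Mod C) = card (rcosets C)" by (simp add: order_def FactGroup_def)
    then show ?thesis using lagrange[OF subgroup_axioms] by (metis dvd_triv_left)
  qed
qed

lemma (in group) commute_iff:
  assumes "x \<in> carrier G" "g \<in> carrier G"
  shows "g \<otimes> x = x \<otimes> g \<longleftrightarrow> g \<otimes> x \<otimes> inv g \<otimes> inv x = \<one>"
proof -
  have "g \<otimes> x \<otimes> inv g \<otimes> inv x = (g \<otimes> x) \<otimes> inv (x \<otimes> g)"
    using assms by (simp add: m_assoc inv_mult_group)
  then show ?thesis using assms inv_solve_right'[of \<one> "g \<otimes> x" "x \<otimes> g"] by simp
qed

lemma (in group_hom) hom_commute_iff:
  assumes "x \<in> carrier G" "g \<in> carrier G"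
  shows "h g \<otimes>\<^bsub>H\<^esub> h x = h x \<otimes>\<^bsub>H\<^esub> h g \<longleftrightarrow> h (g \<otimes> x \<otimes> inv g \<otimes> inv x) = \<one>\<^bsub>H\<^esub>"
  using assms H.commute_iff[of "h x" "h g"] by simp

text \<open>The set is the preimage of the centralizer of the image of \<open>h\<close>, hence of
  the centre of \<open>H\<close> when \<open>h\<close> is onto. Its elements have the same image as
  their conjugates.\<close>

lemma (in group_hom) vimage_center_normal:
  "{x \<in> carrier G. \<forall>g\<in>carrier G. h g \<otimes>\<^bsub>H\<^esub> h x = h x \<otimes>\<^bsub>H\<^esub> h g} \<lhd> G" (is "?D \<lhd> G")
proof (rule G.normal_invI)
  have Dc: "x \<in> carrier G" and Dcomm: "g \<in> carrier G \<Longrightarrow> h g \<otimes>\<^bsub>H\<^esub> h x = h x \<otimes>\<^bsub>H\<^esub> h g"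
    if "x \<in> ?D" for x g
    using that by blast+
  have DI: "x \<in> ?D" if "x \<in> carrier G" "\<And>g. g \<in> carrier G \<Longrightarrow> h g \<otimes>\<^bsub>H\<^esub> h x = h x \<otimes>\<^bsub>H\<^esub> h g" for x
    using that by blast
  show "subgroup ?D G"
  proof (rule G.subgroupI)
    show "?D \<subseteq> carrier G" by blast
    have "\<one> \<in> ?D" by simp
    then show "?D \<noteq> {}" by blast
    show "inv x \<in> ?D" if x: "x \<in> ?D" for x
    proof (rule DI)
      show "inv x \<in> carrier G" using Dc[OF x] by simp
      show "h g \<otimes>\<^bsub>H\<^esub> h (inv x) = h (inv x) \<otimes>\<^bsub>H\<^esub> h g" if g: "g \<in> carrier G" for g
        using H.commute_inv[OF _ _ Dcomm[OF x g]] Dc[OF x] g by (simp only: hom_inv hom_closed)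
    qed
    show "x \<otimes> y \<in> ?D" if x: "x \<in> ?D" and y: "y \<in> ?D" for x y
    proof (rule DI)
      show "x \<otimes> y \<in> carrier G" using Dc[OF x] Dc[OF y] by simp
      show "h g \<otimes>\<^bsub>H\<^esub> h (x \<otimes> y) = h (x \<otimes> y) \<otimes>\<^bsub>H\<^esub> h g" if g: "g \<in> carrier G" for g
        using H.commute_mult[OF _ _ _ Dcomm[OF x g] Dcomm[OF y g]] Dc[OF x] Dc[OF y] g
        by (simp only: hom_mult hom_closed)
    qed
  qed
  fix g x assume g: "g \<in> carrier G" and "x \<in> ?D"
  note x = Dc[OF this(2)] Dcomm[OF this(2)]
  have "h (g \<otimes> x \<otimes> inv g) = h x"
    using x(1) g x(2)[OF g] by (simp add: H.m_assoc)
  then show "g \<otimes> x \<otimes> inv g \<in> ?D"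
    using x g by (intro DI) (simp_all only: G.m_closed G.inv_closed)
qed

lemma (in group_hom) kernel_subset_vimage_center:
  assumes "C \<subseteq> carrier G" "\<And>x. x \<in> C \<Longrightarrow> h x = \<one>\<^bsub>H\<^esub>"
  shows "C \<subseteq> {x \<in> carrier G. \<forall>g\<in>carrier G. h g \<otimes>\<^bsub>H\<^esub> h x = h x \<otimes>\<^bsub>H\<^esub> h g}"
proof
  fix x assume "x \<in> C"
  then show "x \<in> {x \<in> carrier G. \<forall>g\<in>carrier G. h g \<otimes>\<^bsub>H\<^esub> h x = h x \<otimes>\<^bsub>H\<^esub> h g}"
    using assms by (simp add: subset_iff)
qed

text \<open>Nilpotency of finite \<open>p\<close>-groups: a normal subgroup \<open>C\<close> that is maximal among those
  containing \<open>B\<close> but not \<open>A\<close> satisfies \<open>[A, G] \<subseteq> C\<close>, since the preimage of the centre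
  of \<open>G/C\<close> is larger than \<open>C\<close>.\<close>
lemma (in group) normal_subset_by_commutators:
  assumes p: "Factorial_Ring.prime (p::nat)" and ord: "order G dvd p ^ k"
    and A: "A \<lhd> G" and B: "B \<lhd> G"
    and step: "\<And>C. \<lbrakk>C \<lhd> G; B \<subseteq> C;
      \<And>a g. \<lbrakk>a \<in> A; g \<in> carrier G\<rbrakk> \<Longrightarrow> g \<otimes> a \<otimes> inv g \<otimes> inv a \<in> C\<rbrakk> \<Longrightarrow> A \<subseteq> C"
  shows "A \<subseteq> B"
proof (rule ccontr)
  assume "\<not> A \<subseteq> B"
  define \<C> where "\<C> = {C. C \<lhd> G \<and> B \<subseteq> C \<and> \<not> A \<subseteq> C}"
  have Ac: "A \<subseteq> carrier G" using A normal_imp_subgroup subgroup.subset by blast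
  have "order G \<noteq> 0" using ord p by (metis dvd_0_left_iff not_prime_0 power_eq_0_iff)
  then have fin: "finite (carrier G)" using order_gt_0_iff_finite by blast
  have "\<C> \<subseteq> Pow (carrier G)" using normal_imp_subgroup[THEN subgroup.subset] by (auto simp: \<C>_def)
  then have "finite \<C>" using fin finite_subset by blast
  moreover have "B \<in> \<C>" using B \<open>\<not> A \<subseteq> B\<close> by (simp add: \<C>_def)
  ultimately obtain C where C: "C \<in> \<C>" and Cmax: "\<And>D. D \<in> \<C> \<Longrightarrow> C \<subseteq> D \<Longrightarrow> D = C"
    using finite_has_maximal[of \<C>] by auto
  interpret C: normal C G using C by (simp add: \<C>_def)
  obtain Q :: "'a set monoid" and h where "group_hom G Q h" and surj: "h ` carrier G = carrier Q"
    and h1: "\<And>x. x \<in> carrier G \<Longrightarrow> h x = \<one>\<^bsub>Q\<^esub> \<longleftrightarrow> x \<in> C" and ordQ: "order Q dvd order G"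
    using quotient_hom[OF C.normal_axioms] by blast
  then interpret h: group_hom G Q h by simp
  have hA: "h ` A \<lhd> Q"
    using normal.surj_hom_normal_subgroup[OF A h.group_hom_axioms surj] .
  have "h ` A \<noteq> {\<one>\<^bsub>Q\<^esub>}"
  proof
    assume "h ` A = {\<one>\<^bsub>Q\<^esub>}"
    then have "h a = \<one>\<^bsub>Q\<^esub>" if "a \<in> A" for a
      using that by (metis imageI singletonD)
    then have "A \<subseteq> C" using h1 Ac by (meson subset_iff)
    then show False using C by (simp add: \<C>_def)
  qed
  then obtain a' where a': "a' \<in> h ` A" "a' \<noteq> \<one>\<^bsub>Q\<^esub>"
    "\<And>g. g \<in> carrier Q \<Longrightarrow> g \<otimes>\<^bsub>Q\<^esub> a' = a' \<otimes>\<^bsub>Q\<^esub> g"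
    using h.H.normal_meets_center[OF p dvd_trans[OF ordQ ord] hA] by blast
  then obtain a where a: "a \<in> A" "a' = h a" by auto
  define D where "D = {x \<in> carrier G. \<forall>g\<in>carrier G. h g \<otimes>\<^bsub>Q\<^esub> h x = h x \<otimes>\<^bsub>Q\<^esub> h g}"
  have Dn: "D \<lhd> G" unfolding D_def by (rule h.vimage_center_normal)
  have CD: "C \<subseteq> D" unfolding D_def using h1 C.subset by (intro h.kernel_subset_vimage_center) auto
  have "a \<in> D" unfolding D_def using a a'(3) Ac by (intro CollectI conjI ballI) auto
  moreover have "a \<notin> C" using a a'(2) Ac h1 by (metis subsetD)
  \<comment> \<open>The element \<open>a\<close> makes \<open>D\<close> properly larger than
    \<open>C\<close>, so by maximality \<open>D\<close> is not in \<open>\<C>\<close> and must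
    contain \<open>A\<close>. Thus \<open>A\<close> is central modulo \<open>C\<close>, which is the
    premise of \<open>step\<close>.\<close>
  ultimately have AD: "A \<subseteq> D" using CD C Cmax[of D] Dn by (auto simp: \<C>_def)
  have "A \<subseteq> C"
  proof (rule step)
    show "C \<lhd> G" "B \<subseteq> C" using C by (simp_all add: \<C>_def)
    fix a g assume "a \<in> A" and g: "g \<in> carrier G"
    then have a: "a \<in> carrier G" and "h g \<otimes>\<^bsub>Q\<^esub> h a = h a \<otimes>\<^bsub>Q\<^esub> h g"
      using AD by (simp_all add: D_def subset_iff)
    then have "h (g \<otimes> a \<otimes> inv g \<otimes> inv a) = \<one>\<^bsub>Q\<^esub>"
      using h.hom_commute_iff[OF a g] by simp
    then show "g \<otimes> a \<otimes> inv g \<otimes> inv a \<in> C"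
      using h1[of "g \<otimes> a \<otimes> inv g \<otimes> inv a"] a g by simp
  qed
  then show False using C by (simp add: \<C>_def)
qed

section \<open>The power series of a powerful normal subgroup\<close>

abbreviation commutator :: "('a, 'b) monoid_scheme \<Rightarrow> 'a \<Rightarrow> 'a \<Rightarrow> 'a" where
  "commutator G g x \<equiv> g \<otimes>\<^bsub>G\<^esub> x \<otimes>\<^bsub>G\<^esub> inv\<^bsub>G\<^esub> g \<otimes>\<^bsub>G\<^esub> inv\<^bsub>G\<^esub> x"

lemma (in group) commutator_mult:
  assumes "g \<in> carrier G" "x \<in> carrier G"
  shows "g \<otimes> x = commutator G g x \<otimes> (x \<otimes> g)"
proof -
  have "commutator G g x \<otimes> (x \<otimes> g) = (g \<otimes> x \<otimes> inv g) \<otimes> (inv x \<otimes> (x \<otimes> g))"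
    using assms by (simp add: m_assoc)
  also have "inv x \<otimes> (x \<otimes> g) = g" using assms by (simp add: m_assoc[symmetric])
  also have "g \<otimes> x \<otimes> inv g \<otimes> g = g \<otimes> x" using assms by (simp add: m_assoc)
  finally show ?thesis by simp
qed

lemma (in group) conj_nat_pow:
  assumes "g \<in> carrier G" "x \<in> carrier G"
  shows "g \<otimes> x [^] (n::nat) \<otimes> inv g = (g \<otimes> x \<otimes> inv g) [^] n"
proof (induction n)
  case 0
  then show ?case using assms by simp
next
  case (Suc n)
  have "g \<otimes> x [^] Suc n \<otimes> inv g = (g \<otimes> x [^] n \<otimes> inv g) \<otimes> (g \<otimes> x \<otimes> inv g)"
    using assms by (simp add: m_assoc) (simp add: m_assoc[symmetric])
  then show ?case using Suc by simp
qed

lemma (in group) generate_powers_normal: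
  assumes "M \<lhd> G"
  shows "generate G {x [^] (n::nat) | x. x \<in> M} \<lhd> G"
proof (rule normal_generateI)
  interpret M: normal M G by fact
  show "{x [^] n |x. x \<in> M} \<subseteq> carrier G" by auto
  fix h g assume "h \<in> {x [^] n |x. x \<in> M}" and g: "g \<in> carrier G"
  then obtain x where x: "x \<in> M" "h = x [^] n" by auto
  then show "g \<otimes> h \<otimes> inv g \<in> {x [^] n |x. x \<in> M}"
    using conj_nat_pow[OF g, of x n] M.inv_op_closed2[OF g, of x] by auto
qed

lemma (in group) pth_powers_normal: "M \<lhd> G \<Longrightarrow> pth_powers G p M \<lhd> G"
  unfolding pth_powers_def by (rule generate_powers_normal)

lemma (in group) pth_powers_subset:
  assumes "subgroup M G"
  shows "pth_powers G p M \<subseteq> M"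
proof -
  have "x [^] p \<in> M" if "x \<in> M" for x
    using that subgroup.one_closed[OF assms] subgroup.m_closed[OF assms] by (induction p) simp_all
  then show ?thesis unfolding pth_powers_def using assms by (intro generate_subgroup_incl) auto
qed

lemma pth_powersI: "x \<in> M \<Longrightarrow> x [^]\<^bsub>G\<^esub> p \<in> pth_powers G p M"
  unfolding pth_powers_def by (rule generate.incl) blast

text \<open>For a generator \<open>m [^] p\<close> this is \<open>conj_pow_eq\<close> applied to the
  images of \<open>g\<close>, \<open>m\<close>, \<open>c = [g, m]\<close> and
  \<open>d = [m, c]\<close>. Commutation then extends from generators to the whole subgroup.\<close>

lemma (in group_hom) hom_commute_pth_powers:
  assumes "odd p" and M: "M \<subseteq> carrier G" and g: "g \<in> carrier G"
    and pw: "\<And>m. m \<in> M \<Longrightarrow> h (commutator G g m) [^]\<^bsub>H\<^esub> p = \<one>\<^bsub>H\<^esub>"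
    and central: "\<And>m y. m \<in> M \<Longrightarrow> y \<in> carrier G \<Longrightarrow>
      h (commutator G m (commutator G g m)) \<otimes>\<^bsub>H\<^esub> h y = h y \<otimes>\<^bsub>H\<^esub> h (commutator G m (commutator G g m))"
    and x: "x \<in> pth_powers G p M"
  shows "h g \<otimes>\<^bsub>H\<^esub> h x = h x \<otimes>\<^bsub>H\<^esub> h g"
proof (rule H.commute_generate)
  let ?S = "{x [^] p |x. x \<in> M}"
  have S: "?S \<subseteq> carrier G" using M by auto
  show "h x \<in> generate H (h ` ?S)"
    using x generate_img[OF S] unfolding pth_powers_def by blast
  show "h ` ?S \<subseteq> carrier H" using S by auto
  show "h g \<in> carrier H" using g by simp
  fix s assume "s \<in> h ` ?S"
  then obtain m where m: "m \<in> M" and s: "s = h m [^]\<^bsub>H\<^esub> p" using M by (auto simp: hom_nat_pow)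
  have mc: "m \<in> carrier G" using m M by auto
  define c where "c = commutator G g m"
  define d where "d = commutator G m c"
  have c: "c \<in> carrier G" using g mc by (simp add: c_def)
  have d: "d \<in> carrier G" using c mc by (simp add: d_def)
  have gm: "g \<otimes> m = c \<otimes> (m \<otimes> g)" unfolding c_def by (rule G.commutator_mult[OF g mc])
  have mc': "m \<otimes> c = d \<otimes> (c \<otimes> m)" unfolding d_def by (rule G.commutator_mult[OF mc c])
  show "h g \<otimes>\<^bsub>H\<^esub> s = s \<otimes>\<^bsub>H\<^esub> h g" unfolding s
  proof (rule H.conj_pow_eq[of _ _ "h c" "h d"])
    show "h g \<otimes>\<^bsub>H\<^esub> h m = h c \<otimes>\<^bsub>H\<^esub> (h m \<otimes>\<^bsub>H\<^esub> h g)" using arg_cong[OF gm, of h] g mc c by simp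
    show "h m \<otimes>\<^bsub>H\<^esub> h c = h d \<otimes>\<^bsub>H\<^esub> (h c \<otimes>\<^bsub>H\<^esub> h m)" using arg_cong[OF mc', of h] d mc c by simp
    show "h d \<otimes>\<^bsub>H\<^esub> h m = h m \<otimes>\<^bsub>H\<^esub> h d" "h d \<otimes>\<^bsub>H\<^esub> h c = h c \<otimes>\<^bsub>H\<^esub> h d"
      using central[OF m] mc c unfolding c_def[symmetric] d_def[symmetric] by blast+
    show "h c [^]\<^bsub>H\<^esub> p = \<one>\<^bsub>H\<^esub>" using pw[OF m] by (simp only: c_def)
  qed (use g mc c d \<open>odd p\<close> in simp_all)
qed

text \<open>With \<open>P\<close> the subgroup generated by the \<open>p\<close>-th powers of
  \<open>M\<close>, the subgroup \<open>[N, P]\<close> may be assumed central modulo some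
  \<open>C\<close> containing the \<open>p\<close>-th powers of \<open>P\<close>. There
  \<open>c = [g, m]\<close> lies in \<open>P\<close>, so its \<open>p\<close>-th power dies, and
  \<open>[m, c]\<close> lies in \<open>[N, P]\<close>, so it is central. Hence \<open>g\<close>
  commutes with \<open>m [^] p\<close> modulo \<open>C\<close>.\<close>

lemma (in group) pth_powers_powerfully_embedded:
  assumes p: "Factorial_Ring.prime (p::nat)" "odd p" and ord: "order G dvd p ^ k"
    and M: "M \<lhd> G" and N: "N \<lhd> G" and MN: "M \<subseteq> N"
    and comm: "\<And>g x. \<lbrakk>g \<in> N; x \<in> M\<rbrakk> \<Longrightarrow> commutator G g x \<in> pth_powers G p M"
    and g: "g \<in> N" and x: "x \<in> pth_powers G p M"
  shows "commutator G g x \<in> pth_powers G p (pth_powers G p M)"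
proof -
  define P where "P = pth_powers G p M"
  have Pn: "P \<lhd> G" unfolding P_def using M by (rule pth_powers_normal)
  interpret M: normal M G by fact
  interpret N: normal N G by fact
  interpret P: normal P G by fact
  \<comment> \<open>\<open>generate G S\<close> is \<open>[N, P]\<close>. It is normal because
    conjugation permutes these commutators.\<close>
  define S where "S = {commutator G g x | g x. g \<in> N \<and> x \<in> P}"
  have Sc: "S \<subseteq> carrier G" by (auto simp: S_def)
  have conj_comm: "y \<otimes> commutator G g x \<otimes> inv y = commutator G (y \<otimes> g \<otimes> inv y) (y \<otimes> x \<otimes> inv y)"
    if [simp]: "y \<in> carrier G" "g \<in> carrier G" "x \<in> carrier G" for y g x
    by (simp add: m_assoc inv_mult_group) (simp add: m_assoc[symmetric])
  have An: "generate G S \<lhd> G"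
  proof (rule normal_generateI[OF Sc])
    fix s y assume "s \<in> S" and y: "y \<in> carrier G"
    then obtain g x where gx: "g \<in> N" "x \<in> P" and s: "s = commutator G g x" by (auto simp: S_def)
    then have "y \<otimes> s \<otimes> inv y = commutator G (y \<otimes> g \<otimes> inv y) (y \<otimes> x \<otimes> inv y)"
      using conj_comm[OF y, of g x] by simp
    then show "y \<otimes> s \<otimes> inv y \<in> S"
      using N.inv_op_closed2[OF y gx(1)] P.inv_op_closed2[OF y gx(2)]
      unfolding S_def by blast
  qed
  have "generate G S \<subseteq> pth_powers G p P"
  proof (rule normal_subset_by_commutators[OF p(1) ord An pth_powers_normal[OF Pn]])
    fix C assume C: "C \<lhd> G" and PC: "pth_powers G p P \<subseteq> C"
      and AC: "\<And>a g. \<lbrakk>a \<in> generate G S; g \<in> carrier G\<rbrakk> \<Longrightarrow> commutator G g a \<in> C"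
    obtain Q :: "'a set monoid" and h where "group_hom G Q h" and "h ` carrier G = carrier Q"
      and h1: "\<And>x. x \<in> carrier G \<Longrightarrow> h x = \<one>\<^bsub>Q\<^esub> \<longleftrightarrow> x \<in> C" and "order Q dvd order G"
      using quotient_hom[OF C] by blast
    then interpret h: group_hom G Q h by simp
    have central: "h y \<otimes>\<^bsub>Q\<^esub> h a = h a \<otimes>\<^bsub>Q\<^esub> h y" if "a \<in> generate G S" "y \<in> carrier G" for a y
    proof -
      have a: "a \<in> carrier G" using that(1) generate_in_carrier[OF Sc] by simp
      show ?thesis unfolding h.hom_commute_iff[OF a that(2)]
        using AC[OF that] h1[of "commutator G y a"] a that(2) by simp
    qed
    have "s \<in> C" if "s \<in> S" for s
    proof -
      obtain g x where g: "g \<in> N" and x: "x \<in> P" and s: "s = commutator G g x"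
        using \<open>s \<in> S\<close> by (auto simp: S_def)
      have "h g \<otimes>\<^bsub>Q\<^esub> h x = h x \<otimes>\<^bsub>Q\<^esub> h g"
      proof (rule h.hom_commute_pth_powers[OF \<open>odd p\<close>])
        show "M \<subseteq> carrier G" "g \<in> carrier G" "x \<in> pth_powers G p M"
          using g x M.subset by (simp_all add: P_def)
        fix m assume m: "m \<in> M"
        have c: "commutator G g m \<in> P" unfolding P_def using comm[OF g m] .
        show "h (commutator G g m) [^]\<^bsub>Q\<^esub> p = \<one>\<^bsub>Q\<^esub>"
          using h1[of "commutator G g m [^] p"] pth_powersI[OF c, of G p] PC P.mem_carrier[OF c]
          by (metis h.hom_nat_pow nat_pow_closed subsetD)
        \<comment> \<open>Here \<open>M \<subseteq> N\<close> enters: \<open>m\<close> plays the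
          role of the element of \<open>N\<close>, and the inner commutator that of the element of
          \<open>P\<close>.\<close>
        have "commutator G m (commutator G g m) \<in> S"
          unfolding S_def using c m MN by blast
        then show "h (commutator G m (commutator G g m)) \<otimes>\<^bsub>Q\<^esub> h y =
          h y \<otimes>\<^bsub>Q\<^esub> h (commutator G m (commutator G g m))" if "y \<in> carrier G" for y
          using central[OF generate.incl that] by metis
      qed
      then show "s \<in> C"
        using h.hom_commute_iff[of x g] h1[of s] g x unfolding s by simp
    qed
    then show "generate G S \<subseteq> C"
      using C by (intro generate_subgroup_incl normal_imp_subgroup) auto
  qed
  then show ?thesis
    using g x generate.incl[of _ S G] unfolding S_def P_def by blast
qed

text \<open>\<open>pow_generate_class2\<close> for the image of \<open>S\<close>, with the
  commutators formed in \<open>G\<close>, where the containments between subgroups are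
  known.\<close>

lemma (in group_hom) hom_pow_generate:
  assumes S: "S \<subseteq> carrier G" and "odd (p::nat)"
    and pw: "\<And>s. s \<in> S \<Longrightarrow> h s [^]\<^bsub>H\<^esub> p = \<one>\<^bsub>H\<^esub>"
    and comm: "\<And>s t u. \<lbrakk>s \<in> S; t \<in> S; u \<in> S\<rbrakk> \<Longrightarrow>
      h (commutator G s t) \<otimes>\<^bsub>H\<^esub> h u = h u \<otimes>\<^bsub>H\<^esub> h (commutator G s t)"
    and x: "x \<in> generate G S"
  shows "h x [^]\<^bsub>H\<^esub> p = \<one>\<^bsub>H\<^esub>"
proof (rule H.pow_generate_class2)
  show "h x \<in> generate H (h ` S)" using x generate_img[OF S] by blast
  show "h ` S \<subseteq> carrier H" using S by auto
  show "odd p" by fact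
  show "s [^]\<^bsub>H\<^esub> p = \<one>\<^bsub>H\<^esub>" if "s \<in> h ` S" for s using that pw by auto
  fix s t assume "s \<in> h ` S" "t \<in> h ` S"
  then obtain s' t' where st: "s' \<in> S" "t' \<in> S" "s = h s'" "t = h t'" by auto
  have c: "s' \<in> carrier G" "t' \<in> carrier G" using st S by auto
  have "h (s' \<otimes> t') = h (commutator G s' t' \<otimes> (t' \<otimes> s'))"
    using G.commutator_mult[OF c] by simp
  then have "s \<otimes>\<^bsub>H\<^esub> t = h (commutator G s' t') \<otimes>\<^bsub>H\<^esub> (t \<otimes>\<^bsub>H\<^esub> s)"
    using c st by (simp add: hom_mult[of "commutator G s' t'"] del: hom_inv)
  then show "\<exists>z\<in>carrier H. s \<otimes>\<^bsub>H\<^esub> t = z \<otimes>\<^bsub>H\<^esub> (t \<otimes>\<^bsub>H\<^esub> s) \<and> (\<forall>u\<in>h ` S. z \<otimes>\<^bsub>H\<^esub> u = u \<otimes>\<^bsub>H\<^esub> z)"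
    using comm[OF st(1,2)] c by (intro bexI[of _ "h (commutator G s' t')"] conjI ballI) auto
qed

text \<open>Modulo a suitable \<open>C\<close> containing the right-hand side, the
  \<open>q\<close>-th powers of elements of \<open>N\<close> have order dividing \<open>p\<close>,
  and their commutators fall into \<open>pth_powers G p P\<close>, which is central modulo
  \<open>C\<close>. So the group \<open>P\<close> that they generate has exponent dividing
  \<open>p\<close> modulo \<open>C\<close>.\<close>

lemma (in group) pth_powers_generate_powers:
  assumes p: "Factorial_Ring.prime (p::nat)" "odd p" and ord: "order G dvd p ^ k"
    and N: "N \<lhd> G" and P: "P = generate G {x [^] (q::nat) | x. x \<in> N}" and PN: "P \<subseteq> N"
    and comm: "\<And>g x. \<lbrakk>g \<in> N; x \<in> P\<rbrakk> \<Longrightarrow> commutator G g x \<in> pth_powers G p P"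
  shows "pth_powers G p P = generate G {x [^] (q * p) | x. x \<in> N}"
proof
  interpret N: normal N G by fact
  have Pn: "P \<lhd> G" unfolding P using N by (rule generate_powers_normal)
  interpret P: normal P G by fact
  have "x [^] (q * p) \<in> pth_powers G p P" if "x \<in> N" for x
  proof -
    have "(x [^] q) [^] p \<in> pth_powers G p P"
      unfolding P using that by (intro pth_powersI generate.incl) blast
    then show ?thesis using that by (simp add: nat_pow_pow)
  qed
  then show "generate G {x [^] (q * p) | x. x \<in> N} \<subseteq> pth_powers G p P"
    using pth_powers_normal[OF Pn] by (intro generate_subgroup_incl normal_imp_subgroup) auto
  show "pth_powers G p P \<subseteq> generate G {x [^] (q * p) | x. x \<in> N}" (is "_ \<subseteq> ?L")
  proof (rule normal_subset_by_commutators[OF p(1) ord pth_powers_normal[OF Pn] generate_powers_normal[OF N]])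
    fix C assume C: "C \<lhd> G" and LC: "?L \<subseteq> C"
      and AC: "\<And>a g. \<lbrakk>a \<in> pth_powers G p P; g \<in> carrier G\<rbrakk> \<Longrightarrow> commutator G g a \<in> C"
    obtain Q :: "'a set monoid" and h where "group_hom G Q h" and "h ` carrier G = carrier Q"
      and h1: "\<And>x. x \<in> carrier G \<Longrightarrow> h x = \<one>\<^bsub>Q\<^esub> \<longleftrightarrow> x \<in> C" and "order Q dvd order G"
      using quotient_hom[OF C] by blast
    then interpret h: group_hom G Q h by simp
    let ?S = "{x [^] q | x. x \<in> N}"
    have S: "?S \<subseteq> carrier G" by auto
    have SP: "s \<in> P" if "s \<in> ?S" for s unfolding P using that by (rule generate.incl)
    have "y [^] p \<in> C" if y: "y \<in> P" for y
    proof -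
      have "h y [^]\<^bsub>Q\<^esub> p = \<one>\<^bsub>Q\<^esub>"
      proof (rule h.hom_pow_generate[OF S \<open>odd p\<close>])
        show "y \<in> generate G ?S" using y unfolding P .
      next
        fix s assume "s \<in> ?S"
        then obtain x where x: "x \<in> N" "s = x [^] q" by auto
        then have "s [^] p \<in> ?L" by (intro generate.incl) (auto simp: nat_pow_pow)
        then have "h (s [^] p) = \<one>\<^bsub>Q\<^esub>" using LC h1[of "s [^] p"] x by auto
        then show "h s [^]\<^bsub>Q\<^esub> p = \<one>\<^bsub>Q\<^esub>" using x by (metis h.hom_nat_pow N.mem_carrier nat_pow_closed)
      next
        fix s t u assume s: "s \<in> ?S" and t: "t \<in> ?S" and u: "u \<in> ?S"
        have c: "s \<in> carrier G" "t \<in> carrier G" "u \<in> carrier G" using s t u S by blast+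
        \<comment> \<open>Both elements lie in \<open>P\<close>; the first is regarded as an element
          of \<open>N\<close>, so that \<open>comm\<close> applies.\<close>
        have "commutator G s t \<in> pth_powers G p P" using comm SP s t PN by blast
        then have "commutator G u (commutator G s t) \<in> C" using AC c by blast
        then have "h u \<otimes>\<^bsub>Q\<^esub> h (commutator G s t) = h (commutator G s t) \<otimes>\<^bsub>Q\<^esub> h u"
          using h.hom_commute_iff[of "commutator G s t" u] h1[of "commutator G u (commutator G s t)"] c
          by (metis m_closed inv_closed)
        then show "h (commutator G s t) \<otimes>\<^bsub>Q\<^esub> h u = h u \<otimes>\<^bsub>Q\<^esub> h (commutator G s t)" by (rule HOL.sym)
      qed
      then show ?thesis using h1[of "y [^] p"] h.hom_nat_pow[of y p] P.mem_carrier[OF y]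
        by (metis nat_pow_closed)
    qed
    then show "pth_powers G p P \<subseteq> C"
      unfolding pth_powers_def using C by (intro generate_subgroup_incl normal_imp_subgroup) auto
  qed
qed

text \<open>The four facts go through one induction, since normality, containment in
  \<open>N\<close> and the commutator bound at stage \<open>i\<close> feed both the commutator bound
  and the description by powers at the next stage.\<close>

lemma (in group) powerful_series:
  fixes N p
  defines "P \<equiv> \<lambda>i. (pth_powers G p ^^ i) N"
  assumes p: "Factorial_Ring.prime (p::nat)" "odd p" and ord: "order G dvd p ^ k"
    and N: "N \<lhd> G" and pow: "powerful G p N"
  shows "P i \<lhd> G" "P i \<subseteq> N"
    "\<And>g x. \<lbrakk>g \<in> N; x \<in> P i\<rbrakk> \<Longrightarrow> commutator G g x \<in> P (Suc i)"
    "P i = generate G {x [^] (p ^ i) | x. x \<in> N}"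
proof -
  interpret N: normal N G by fact
  have "P i \<lhd> G \<and> P i \<subseteq> N \<and> (\<forall>g\<in>N. \<forall>x\<in>P i. commutator G g x \<in> P (Suc i)) \<and>
    P i = generate G {x [^] (p ^ i) | x. x \<in> N}"
  proof (induction i)
    case 0
    have "{x [^] (p ^ 0) | x. x \<in> N} = N" by force
    then have "N = generate G {x [^] (p ^ 0) | x. x \<in> N}"
      using generateI[OF N.subgroup_axioms subset_refl] by auto
    moreover have "commutator G g x \<in> pth_powers G p N" if "g \<in> N" "x \<in> N" for g x
    proof -
      have "commutator G g x \<in> derived G N"
        unfolding derived_def using that by (intro generate.incl) blast
      then show ?thesis using pow unfolding powerful_def by blast
    qed
    ultimately show ?case using N by (simp add: P_def)
  next
    case (Suc i)
    then have IH: "P i \<lhd> G" "P i \<subseteq> N" "P i = generate G {x [^] (p ^ i) | x. x \<in> N}"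
      and comm: "\<And>g x. \<lbrakk>g \<in> N; x \<in> P i\<rbrakk> \<Longrightarrow> commutator G g x \<in> pth_powers G p (P i)"
      by (auto simp: P_def)
    have S: "P (Suc j) = pth_powers G p (P j)" for j by (simp add: P_def)
    have "P (Suc i) \<lhd> G" unfolding S using IH(1) by (rule pth_powers_normal)
    moreover have "P (Suc i) \<subseteq> N"
      unfolding S using pth_powers_subset[OF normal_imp_subgroup[OF IH(1)]] IH(2) by blast
    moreover have "commutator G g x \<in> P (Suc (Suc i))" if "g \<in> N" "x \<in> P (Suc i)" for g x
      using pth_powers_powerfully_embedded[OF p ord IH(1) N IH(2) comm that(1)] that(2) unfolding S by blast
    moreover have "P (Suc i) = generate G {x [^] (p ^ i * p) | x. x \<in> N}"
      unfolding S using pth_powers_generate_powers[OF p ord N IH(3,2) comm] .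
    ultimately show ?case by (simp add: mult.commute)
  qed
  then show "P i \<lhd> G" "P i \<subseteq> N"
    "\<And>g x. \<lbrakk>g \<in> N; x \<in> P i\<rbrakk> \<Longrightarrow> commutator G g x \<in> P (Suc i)"
    "P i = generate G {x [^] (p ^ i) | x. x \<in> N}"
    by blast+
qed

lemma (in group) generate_powers_trivial:
  assumes "\<And>x. x \<in> N \<Longrightarrow> x [^] (n::nat) = \<one>"
  shows "generate G {x [^] n | x. x \<in> N} \<subseteq> {\<one>}"
  using assms by (intro generate_subgroup_incl triv_subgroup) auto

section \<open>Exterior pairings\<close>

context group begin

lemma conjg_closed [simp]: "\<lbrakk>g \<in> carrier G; x \<in> carrier G\<rbrakk> \<Longrightarrow> conjg G g x \<in> carrier G"
  by (simp add: conjg_def)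

lemma conjg_conjg:
  "\<lbrakk>g \<in> carrier G; h \<in> carrier G; x \<in> carrier G\<rbrakk> \<Longrightarrow> conjg G g (conjg G h x) = conjg G (g \<otimes> h) x"
  by (simp add: conjg_def m_assoc inv_mult_group)

lemma conjg_mult:
  assumes [simp]: "g \<in> carrier G" "x \<in> carrier G" "y \<in> carrier G"
  shows "conjg G g (x \<otimes> y) = conjg G g x \<otimes> conjg G g y"
proof -
  have "inv g \<otimes> (g \<otimes> (y \<otimes> inv g)) = y \<otimes> inv g" by (simp add: m_assoc[symmetric])
  then show ?thesis by (simp add: conjg_def m_assoc)
qed

lemma conjg_one [simp]: "x \<in> carrier G \<Longrightarrow> conjg G \<one> x = x"
  by (simp add: conjg_def)

lemma conjg_mult_swap:
  "\<lbrakk>g \<in> carrier G; x \<in> carrier G\<rbrakk> \<Longrightarrow> conjg G g x \<otimes> g = g \<otimes> x"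
  by (simp add: conjg_def m_assoc)

lemma conjg_commute:
  "\<lbrakk>g \<in> carrier G; x \<in> carrier G; g \<otimes> x = x \<otimes> g\<rbrakk> \<Longrightarrow> conjg G g x = x"
  by (simp add: conjg_def m_assoc)

lemma conjg_eq_commutator_mult:
  "\<lbrakk>g \<in> carrier G; x \<in> carrier G\<rbrakk> \<Longrightarrow> conjg G g x = commutator G g x \<otimes> x"
  by (simp add: conjg_def m_assoc)

text \<open>With the commutator on the right, it can be absorbed by \<open>w_absorb_left\<close> and
  \<open>w_absorb_right\<close> once it lies in \<open>L\<close>.\<close>

lemma conjg_eq_mult_commutator:
  assumes "g \<in> carrier G" "x \<in> carrier G"
  shows "conjg G g x = x \<otimes> commutator G (inv x) g"
  using assms by (simp add: conjg_def m_assoc) (simp add: m_assoc[symmetric])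

lemma commutator_mult_left:
  assumes [simp]: "x \<in> carrier G" "y \<in> carrier G" "g \<in> carrier G"
  shows "commutator G (x \<otimes> y) g = conjg G x (commutator G y g) \<otimes> commutator G x g"
proof -
  have "inv x \<otimes> (x \<otimes> (g \<otimes> (inv x \<otimes> inv g))) = g \<otimes> (inv x \<otimes> inv g)"
    by (simp add: m_assoc[symmetric])
  moreover have "inv g \<otimes> (g \<otimes> (inv x \<otimes> inv g)) = inv x \<otimes> inv g"
    by (simp add: m_assoc[symmetric])
  ultimately show ?thesis by (simp add: conjg_def m_assoc inv_mult_group)
qed

end

lemma (in normal) conjg_mem: "\<lbrakk>g \<in> carrier G; x \<in> H\<rbrakk> \<Longrightarrow> conjg G g x \<in> H"
  unfolding conjg_def by (rule inv_op_closed2)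

lemma (in normal) commutator_mem:
  assumes "x \<in> H" "g \<in> carrier G"
  shows "commutator G x g \<in> H"
proof -
  have "commutator G x g = x \<otimes> (g \<otimes> inv x \<otimes> inv g)" using assms by (simp add: m_assoc)
  then show ?thesis using assms inv_op_closed2[of g "inv x"] by simp
qed

text \<open>The target \<open>E\<close> is left arbitrary because the defining relations survive
  composition with a homomorphism; the same identities are thus available in quotients of the
  exterior product.\<close>

locale exterior_pairing = normal N G + E: group E
  for N and G (structure) and E (structure) +
  fixes w
  assumes w_closed [simp]: "\<lbrakk>n \<in> N; g \<in> carrier G\<rbrakk> \<Longrightarrow> w n g \<in> carrier E"
    and w_left: "\<lbrakk>n \<in> N; n' \<in> N; g \<in> carrier G\<rbrakk> \<Longrightarrow>
      w (n \<otimes> n') g = w (conjg G n n') (conjg G n g) \<otimes>\<^bsub>E\<^esub> w n g"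
    and w_right: "\<lbrakk>n \<in> N; g \<in> carrier G; g' \<in> carrier G\<rbrakk> \<Longrightarrow>
      w n (g \<otimes> g') = w n g \<otimes>\<^bsub>E\<^esub> w (conjg G g n) (conjg G g g')"
    and w_diag: "x \<in> N \<Longrightarrow> w x x = \<one>\<^bsub>E\<^esub>"
begin

lemma w_one_left: "g \<in> carrier G \<Longrightarrow> w \<one> g = \<one>\<^bsub>E\<^esub>"
  using w_left[of \<one> \<one> g] E.l_cancel_one'[of "w \<one> g" "w \<one> g"] by simp

text \<open>Expanding \<open>w (x y) (x y)\<close>, with \<open>y\<close> written as a conjugate by \<open>x\<close>.\<close>
lemma w_swap:
  assumes x: "x \<in> N" and y: "y \<in> N"
  shows "w y x \<otimes>\<^bsub>E\<^esub> w x y = \<one>\<^bsub>E\<^esub>"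
proof -
  define z where "z = conjg G (inv x) y"
  have z: "z \<in> N" using conjg_mem x y by (simp add: z_def)
  have xc: "x \<in> carrier G" "y \<in> carrier G" "z \<in> carrier G" using x y z by simp_all
  have zy: "conjg G x z = y" using xc by (simp add: z_def conjg_conjg)
  have xz: "x \<otimes> z = y \<otimes> x" using conjg_mult_swap[of x z] xc zy by simp
  have xx: "conjg G x x = x" using xc by (intro conjg_commute) simp_all
  have yy: "conjg G y y = y" using xc by (intro conjg_commute) simp_all
  have "w x (x \<otimes> z) = w x y"
    using w_right[OF x, of x z] w_diag[OF x] xc x y xx zy by simp
  moreover have "w y (x \<otimes> y) = w y x"
  proof -
    have "w (conjg G x y) (conjg G x y) = \<one>\<^bsub>E\<^esub>" using w_diag conjg_mem[OF xc(1) y] by simp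
    then show ?thesis using w_right[OF y, of x y] xc x y by simp
  qed
  moreover have "w (x \<otimes> z) (x \<otimes> z) = w (conjg G x z) (conjg G x (x \<otimes> z)) \<otimes>\<^bsub>E\<^esub> w x (x \<otimes> z)"
    using w_left[OF x z, of "x \<otimes> z"] xc by simp
  moreover have "conjg G x (x \<otimes> z) = x \<otimes> y" using xc xx zy by (simp add: conjg_mult)
  ultimately show ?thesis using w_diag[of "x \<otimes> z"] x z by (simp add: zy)
qed

text \<open>The two ways to expand \<open>w (n m) (g h)\<close>.\<close>
lemma w_conj_aux:
  assumes n: "n \<in> N" and m: "m \<in> N" and g: "g \<in> carrier G" and h: "h \<in> carrier G"
  shows "w n g \<otimes>\<^bsub>E\<^esub> w (conjg G (g \<otimes> n) m) (conjg G (g \<otimes> n) h)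
    = w (conjg G (n \<otimes> g) m) (conjg G (n \<otimes> g) h) \<otimes>\<^bsub>E\<^esub> w n g"
proof -
  have [simp]: "n \<in> carrier G" "m \<in> carrier G" using n m by simp_all
  note [simp] = n m g h conjg_mem conjg_conjg
  let ?a = "w (conjg G n m) (conjg G n g)" and ?b = "w (conjg G g n) (conjg G g h)"
  let ?x = "w (conjg G (n \<otimes> g) m) (conjg G (n \<otimes> g) h)"
  let ?y = "w (conjg G (g \<otimes> n) m) (conjg G (g \<otimes> n) h)"
  have "w (n \<otimes> m) (g \<otimes> h) = w (conjg G n m) (conjg G n g \<otimes> conjg G n h) \<otimes>\<^bsub>E\<^esub> w n (g \<otimes> h)"
    by (simp add: w_left conjg_mult)
  also have "w (conjg G n m) (conjg G n g \<otimes> conjg G n h) = ?a \<otimes>\<^bsub>E\<^esub> ?x"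
    by (simp add: w_right conjg_mult_swap)
  also have "w n (g \<otimes> h) = w n g \<otimes>\<^bsub>E\<^esub> ?b" by (simp add: w_right)
  finally have 1: "w (n \<otimes> m) (g \<otimes> h) = ?a \<otimes>\<^bsub>E\<^esub> ((?x \<otimes>\<^bsub>E\<^esub> w n g) \<otimes>\<^bsub>E\<^esub> ?b)"
    by (simp add: E.m_assoc)
  have "w (n \<otimes> m) (g \<otimes> h) = w (n \<otimes> m) g \<otimes>\<^bsub>E\<^esub> w (conjg G g n \<otimes> conjg G g m) (conjg G g h)"
    by (simp add: w_right conjg_mult)
  also have "w (n \<otimes> m) g = ?a \<otimes>\<^bsub>E\<^esub> w n g" by (simp add: w_left)
  also have "w (conjg G g n \<otimes> conjg G g m) (conjg G g h) = ?y \<otimes>\<^bsub>E\<^esub> ?b"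
    by (simp add: w_left conjg_mult_swap)
  finally have 2: "w (n \<otimes> m) (g \<otimes> h) = ?a \<otimes>\<^bsub>E\<^esub> ((w n g \<otimes>\<^bsub>E\<^esub> ?y) \<otimes>\<^bsub>E\<^esub> ?b)"
    by (simp add: E.m_assoc)
  have "(w n g \<otimes>\<^bsub>E\<^esub> ?y) \<otimes>\<^bsub>E\<^esub> ?b = (?x \<otimes>\<^bsub>E\<^esub> w n g) \<otimes>\<^bsub>E\<^esub> ?b"
    using 1 2 by (simp add: E.l_cancel)
  then show ?thesis by (simp add: E.r_cancel)
qed

text \<open>Conjugation by \<open>w n g\<close> acts on the values of \<open>w\<close> as
  \<open>[n, g]\<close> acts on \<open>G\<close>. This is \<open>w_conj_aux\<close> with
  \<open>m\<close> and \<open>h\<close> first conjugated by \<open>k = inv (g \<otimes> n)\<close>,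
  because \<open>(n \<otimes> g) \<otimes> k = [n, g]\<close>.\<close>

lemma w_conj:
  assumes n: "n \<in> N" and m: "m \<in> N" and g: "g \<in> carrier G" and h: "h \<in> carrier G"
  defines "d \<equiv> commutator G n g"
  shows "w n g \<otimes>\<^bsub>E\<^esub> w m h = w (conjg G d m) (conjg G d h) \<otimes>\<^bsub>E\<^esub> w n g"
proof -
  have nc: "n \<in> carrier G" "m \<in> carrier G" using n m by simp_all
  define k where "k = inv (g \<otimes> n)"
  have k: "k \<in> carrier G" "(g \<otimes> n) \<otimes> k = \<one>" using nc g by (simp_all add: k_def)
  have d: "(n \<otimes> g) \<otimes> k = d" using nc g by (simp add: k_def d_def inv_mult_group m_assoc)
  have 1: "conjg G (g \<otimes> n) (conjg G k x) = x" "conjg G (n \<otimes> g) (conjg G k x) = conjg G d x"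
    if "x \<in> carrier G" for x
    using that k d nc g by (simp_all add: conjg_conjg)
  show ?thesis
    using w_conj_aux[OF n conjg_mem[OF k(1) m] g conjg_closed[OF k(1) h]]
    unfolding 1[OF nc(2)] 1[OF h] .
qed

text \<open>As \<open>b\<close> fixes \<open>a\<close> and sends \<open>q\<close> to
  \<open>[b, q] \<otimes> q\<close>, \<open>w_left\<close> followed by \<open>w_right\<close> splits
  off \<open>w a [b, q]\<close>, and \<open>w_conj\<close> reorders the rest. With \<open>b\<close>
  a power of \<open>a\<close> this is the recursion for \<open>w (a [^] n) q\<close>.\<close>

lemma w_commute_mult:
  assumes b: "b \<in> N" and a: "a \<in> N" and q: "q \<in> carrier G" and ba: "b \<otimes> a = a \<otimes> b"
  shows "w (b \<otimes> a) q = w a (commutator G b q) \<otimes>\<^bsub>E\<^esub> (w b q \<otimes>\<^bsub>E\<^esub> w a q)"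
proof -
  define d where "d = commutator G b q"
  have c: "a \<in> carrier G" "b \<in> carrier G" "d \<in> carrier G" using a b q by (simp_all add: d_def)
  have "w (b \<otimes> a) q = w a (d \<otimes> q) \<otimes>\<^bsub>E\<^esub> w b q"
    using w_left[OF b a q] conjg_commute[OF c(2,1) ba] conjg_eq_commutator_mult[OF c(2) q]
    by (simp add: d_def)
  also have "w a (d \<otimes> q) = w a d \<otimes>\<^bsub>E\<^esub> w (conjg G d a) (conjg G d q)"
    using a c q by (simp add: w_right)
  also have "\<dots> \<otimes>\<^bsub>E\<^esub> w b q = w a d \<otimes>\<^bsub>E\<^esub> (w (conjg G d a) (conjg G d q) \<otimes>\<^bsub>E\<^esub> w b q)"
    using a b c q conjg_mem by (simp add: E.m_assoc)
  also have "w (conjg G d a) (conjg G d q) \<otimes>\<^bsub>E\<^esub> w b q = w b q \<otimes>\<^bsub>E\<^esub> w a q"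
    using w_conj[OF b a q q] by (simp add: d_def)
  finally show ?thesis by (simp add: d_def)
qed

text \<open>With \<open>d = [b, h]\<close> and \<open>s = [a, q]\<close>,
  \<open>w (d \<otimes> a) q\<close> is expanded twice, the second time with
  \<open>d \<otimes> a\<close> rewritten as \<open>a \<otimes> d'\<close>. Cancelling
  \<open>w d q\<close> shows that conjugation by \<open>d\<close> multiplies \<open>w a q\<close> by
  \<open>w d s\<close>, and \<open>w_conj\<close> turns this into conjugation by
  \<open>w b h\<close>.\<close>

lemma w_commutator:
  assumes b: "b \<in> N" and h: "h \<in> carrier G" and a: "a \<in> N" and q: "q \<in> carrier G"
  shows "w b h \<otimes>\<^bsub>E\<^esub> w a q
    = w (commutator G b h) (commutator G a q) \<otimes>\<^bsub>E\<^esub> (w a q \<otimes>\<^bsub>E\<^esub> w b h)"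
proof -
  define d where "d = commutator G b h"
  define s where "s = commutator G a q"
  have d: "d \<in> N" using commutator_mem b h by (simp add: d_def)
  have s: "s \<in> N" using commutator_mem a q by (simp add: s_def)
  have c: "a \<in> carrier G" "b \<in> carrier G" "d \<in> carrier G" "s \<in> carrier G" using a b d s by simp_all
  define d' where "d' = conjg G (inv a) d"
  have d': "d' \<in> N" using conjg_mem d c by (simp add: d'_def)
  have ad': "conjg G a d' = d" using c by (simp add: d'_def conjg_conjg)
  have da: "d \<otimes> a = a \<otimes> d'" using conjg_mult_swap[of a d'] c d' ad' by simp
  note [simp] = a b h q d s c d' conjg_mem
  have "w (conjg G d a) (conjg G d q) \<otimes>\<^bsub>E\<^esub> w d q = w (a \<otimes> d') q"
    unfolding da[symmetric] by (simp add: w_left)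
  also have "\<dots> = w d (conjg G a q) \<otimes>\<^bsub>E\<^esub> w a q" by (simp add: w_left ad')
  also have "conjg G a q = s \<otimes> q" using conjg_eq_commutator_mult[of a q] by (simp add: s_def)
  also have "w d (s \<otimes> q) = w d s \<otimes>\<^bsub>E\<^esub> w (conjg G s d) (conjg G s q)" by (simp add: w_right)
  also have "\<dots> \<otimes>\<^bsub>E\<^esub> w a q = w d s \<otimes>\<^bsub>E\<^esub> (w (conjg G s d) (conjg G s q) \<otimes>\<^bsub>E\<^esub> w a q)"
    by (simp add: E.m_assoc)
  also have "w (conjg G s d) (conjg G s q) \<otimes>\<^bsub>E\<^esub> w a q = w a q \<otimes>\<^bsub>E\<^esub> w d q"
    using w_conj[OF a d q q] by (simp add: s_def)
  also have "w d s \<otimes>\<^bsub>E\<^esub> (w a q \<otimes>\<^bsub>E\<^esub> w d q) = (w d s \<otimes>\<^bsub>E\<^esub> w a q) \<otimes>\<^bsub>E\<^esub> w d q"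
    by (simp add: E.m_assoc)
  finally have "w (conjg G d a) (conjg G d q) = w d s \<otimes>\<^bsub>E\<^esub> w a q" by (simp add: E.r_cancel)
  then have "w b h \<otimes>\<^bsub>E\<^esub> w a q = (w d s \<otimes>\<^bsub>E\<^esub> w a q) \<otimes>\<^bsub>E\<^esub> w b h"
    using w_conj[OF b a h q] by (simp add: d_def)
  then show ?thesis by (simp add: E.m_assoc d_def[symmetric] s_def[symmetric])
qed

text \<open>By \<open>w_conj\<close>, a generator \<open>w n g\<close> conjugates
  \<open>w l h\<close> to a value of \<open>w\<close> whose first argument is a conjugate of
  \<open>l\<close>, hence again in \<open>L\<close>.\<close>

lemma w_normal:
  assumes gen: "carrier E = generate E {w n g | n g. n \<in> N \<and> g \<in> carrier G}"
    and L: "L \<lhd> G" and LN: "L \<subseteq> N"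
  shows "generate E {w l g | l g. l \<in> L \<and> g \<in> carrier G} \<lhd> E" (is "generate E ?S \<lhd> E")
proof (rule E.normal_generateI)
  interpret L: normal L G by fact
  show S: "?S \<subseteq> carrier E" using LN by auto
  fix s e assume s: "s \<in> ?S" and e: "e \<in> carrier E"
  have gc: "x \<in> generate E {w n g | n g. n \<in> N \<and> g \<in> carrier G} \<Longrightarrow> x \<in> carrier E" for x
    using gen by simp
  from e have "e \<in> generate E {w n g | n g. n \<in> N \<and> g \<in> carrier G}" using gen by simp
  then show "e \<otimes>\<^bsub>E\<^esub> s \<otimes>\<^bsub>E\<^esub> inv\<^bsub>E\<^esub> e \<in> ?S"
    using s
  proof (induction arbitrary: s rule: generate.induct)
    case one
    then have "s \<in> carrier E" using S by blast
    then show ?case using one by simp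
  next
    case (incl e)
    then obtain n g where ng: "n \<in> N" "g \<in> carrier G" "e = w n g" by auto
    obtain l h where lh: "l \<in> L" "h \<in> carrier G" "s = w l h" using incl by auto
    define d where "d = commutator G n g"
    have d: "d \<in> carrier G" using ng by (simp add: d_def)
    have "l \<in> N" using lh LN by auto
    then have "e \<otimes>\<^bsub>E\<^esub> s \<otimes>\<^bsub>E\<^esub> inv\<^bsub>E\<^esub> e = w (conjg G d l) (conjg G d h)"
      using w_conj[OF ng(1) _ ng(2) lh(2), of l] ng lh d conjg_mem[OF d]
      by (simp add: d_def[symmetric] E.m_assoc)
    moreover have "conjg G d l \<in> L" "conjg G d h \<in> carrier G" using L.conjg_mem d lh by simp_all
    ultimately show ?case by blast
  next
    case (inv e)
    then obtain n g where ng: "n \<in> N" "g \<in> carrier G" "e = w n g" by auto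
    obtain l h where lh: "l \<in> L" "h \<in> carrier G" "s = w l h" using inv by auto
    define d where "d = commutator G n g"
    have d: "d \<in> carrier G" using ng by (simp add: d_def)
    \<comment> \<open>Conjugating by the inverse of a generator undoes the action of
      \<open>d\<close>, so the arguments are moved back by \<open>inv d\<close> before
      \<open>w_conj\<close> is applied.\<close>
    define l' where "l' = conjg G (inv d) l"
    define h' where "h' = conjg G (inv d) h"
    have l': "l' \<in> L" using L.conjg_mem d lh by (simp add: l'_def)
    then have l'N: "l' \<in> N" using LN by auto
    have h': "h' \<in> carrier G" using d lh by (simp add: h'_def)
    have "e \<otimes>\<^bsub>E\<^esub> w l' h' = s \<otimes>\<^bsub>E\<^esub> e"
      using w_conj[OF ng(1) l'N ng(2) h'] ng lh d L.mem_carrier[OF lh(1)]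
      by (simp add: d_def[symmetric] l'_def h'_def conjg_conjg)
    then have "inv\<^bsub>E\<^esub> e \<otimes>\<^bsub>E\<^esub> (s \<otimes>\<^bsub>E\<^esub> e) = w l' h'"
      using ng h' l'N by (metis E.inv_solve_left w_closed E.m_closed)
    moreover have "s \<in> carrier E" "e \<in> carrier E" using inv.prems S ng by auto
    ultimately have "inv\<^bsub>E\<^esub> e \<otimes>\<^bsub>E\<^esub> s \<otimes>\<^bsub>E\<^esub> inv\<^bsub>E\<^esub> (inv\<^bsub>E\<^esub> e) = w l' h'" by (simp add: E.m_assoc)
    then show ?case using l' h' by blast
  next
    case (eng e1 e2)
    have c: "e1 \<in> carrier E" "e2 \<in> carrier E" "s \<in> carrier E"
      using gc eng.hyps eng.prems S by blast+
    have "e1 \<otimes>\<^bsub>E\<^esub> e2 \<otimes>\<^bsub>E\<^esub> s \<otimes>\<^bsub>E\<^esub> inv\<^bsub>E\<^esub> (e1 \<otimes>\<^bsub>E\<^esub> e2)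
      = e1 \<otimes>\<^bsub>E\<^esub> (e2 \<otimes>\<^bsub>E\<^esub> s \<otimes>\<^bsub>E\<^esub> inv\<^bsub>E\<^esub> e2) \<otimes>\<^bsub>E\<^esub> inv\<^bsub>E\<^esub> e1"
      using c by (simp add: E.m_assoc E.inv_mult_group)
    then show ?case using eng by simp
  qed
qed

lemma hom_exterior_pairing:
  assumes "group_hom E Q h"
  shows "exterior_pairing N G Q (\<lambda>n g. h (w n g))"
proof -
  interpret h: group_hom E Q h by fact
  show ?thesis
    by unfold_locales (simp_all add: w_left w_right w_diag conjg_mem)
qed

end

section \<open>One layer between consecutive terms of the power series\<close>

text \<open>In the application \<open>M\<close> and \<open>L\<close> are consecutive terms of the
  series, and \<open>E\<close> is a quotient in which \<open>w\<close> has been made trivial on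
  \<open>L\<close>. Modulo \<open>L\<close> the group \<open>M\<close> is abelian of exponent
  dividing \<open>p\<close>.\<close>

locale exterior_pairing_layer = exterior_pairing +
  fixes L M and p :: nat
  assumes L: "L \<lhd> G" and M: "M \<lhd> G" and MN: "M \<subseteq> N" and LM: "L \<subseteq> M" and odd_p: "odd p"
    and w_L: "\<lbrakk>l \<in> L; g \<in> carrier G\<rbrakk> \<Longrightarrow> w l g = \<one>\<^bsub>E\<^esub>"
    and comm_L: "\<lbrakk>x \<in> M; y \<in> M\<rbrakk> \<Longrightarrow> commutator G x y \<in> L"
    and pow_L: "x \<in> M \<Longrightarrow> x [^] p \<in> L"
begin

sublocale M: normal M G by (rule M)
sublocale L: normal L G by (rule L)

lemma MN': "x \<in> M \<Longrightarrow> x \<in> N" and LN': "x \<in> L \<Longrightarrow> x \<in> N"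
  using MN LM by auto

lemma w_L_right: "\<lbrakk>n \<in> N; l \<in> L\<rbrakk> \<Longrightarrow> w n l = \<one>\<^bsub>E\<^esub>"
  using w_swap[OF LN', of l n] w_L[of l n] by simp

lemma w_absorb_left:
  assumes "a \<in> N" "l \<in> L" "g \<in> carrier G"
  shows "w (a \<otimes> l) g = w a g"
  using assms w_left[OF assms(1) LN'[OF assms(2)] assms(3)] w_L[of "conjg G a l" "conjg G a g"]
    L.conjg_mem[of a l] by simp

lemma w_absorb_right:
  assumes "a \<in> N" "g \<in> carrier G" "l \<in> L"
  shows "w a (g \<otimes> l) = w a g"
  using assms w_right[OF assms(1,2), of l] w_L_right[of "conjg G g a" "conjg G g l"]
    L.conjg_mem[of g l] conjg_mem[of g a] by simp

text \<open>Conjugation inside \<open>M\<close> changes \<open>a\<close> only by a commutator in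
  \<open>L\<close>, which \<open>w\<close> does not see.\<close>

lemma w_conjg_left:
  assumes "a \<in> M" "c \<in> M" "g \<in> carrier G"
  shows "w (conjg G c a) g = w a g"
  using assms conjg_eq_mult_commutator[of c a] comm_L[of "inv a" c]
    w_absorb_left[OF MN'[OF assms(1)] _ assms(3)] by simp

lemma w_conjg_right:
  assumes "a \<in> N" "c \<in> M" "d \<in> M"
  shows "w a (conjg G d c) = w a c"
  using assms conjg_eq_mult_commutator[of d c] comm_L[of "inv c" d]
    w_absorb_right[OF assms(1), of c] by simp

text \<open>On \<open>M\<close> the conjugations in \<open>w_right\<close> have no effect on
  \<open>w\<close>, so the relation becomes additivity in the second argument.\<close>

lemma w_mult_right:
  assumes "a \<in> M" "c \<in> M" "c' \<in> M"
  shows "w a (c \<otimes> c') = w a c \<otimes>\<^bsub>E\<^esub> w a c'"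
  using assms w_right[OF MN'[OF assms(1)], of c c'] w_conjg_left[OF assms(1,2), of "conjg G c c'"]
    w_conjg_right[OF MN'[OF assms(1)] assms(3,2)] by simp

lemma pow_M: "c \<in> M \<Longrightarrow> c [^] (n::nat) \<in> M"
  by (induction n) simp_all

lemma w_pow_right:
  assumes "a \<in> M" "c \<in> M"
  shows "w a (c [^] (n::nat)) = w a c [^]\<^bsub>E\<^esub> n"
proof (induction n)
  case 0
  then show ?case using w_L_right[OF MN'[OF assms(1)] L.one_closed] by simp
next
  case (Suc n)
  then show ?case using w_mult_right[OF assms(1) pow_M[OF assms(2)] assms(2), of n] by simp
qed

lemma w_MM_pow:
  assumes "a \<in> M" "c \<in> M"
  shows "w a c [^]\<^bsub>E\<^esub> p = \<one>\<^bsub>E\<^esub>"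
  using w_pow_right[OF assms, of p] w_L_right[OF MN'[OF assms(1)] pow_L[OF assms(2)]] by simp

text \<open>By \<open>w_conj\<close>, \<open>w n g\<close> acts through \<open>[n, g]\<close>, which
  lies in \<open>M\<close> and hence does not change \<open>w a c\<close>.\<close>

lemma w_MM_central:
  assumes "a \<in> M" "c \<in> M" "n \<in> M" "g \<in> carrier G"
  shows "w a c \<otimes>\<^bsub>E\<^esub> w n g = w n g \<otimes>\<^bsub>E\<^esub> w a c"
proof -
  have d: "commutator G n g \<in> M" using M.commutator_mem assms by simp
  then show ?thesis
    using w_conj[OF MN'[OF assms(3)] MN'[OF assms(1)] assms(4), of c] assms
      w_conjg_left[OF assms(1) d, of "conjg G (commutator G n g) c"]
      w_conjg_right[OF MN'[OF assms(1)] assms(2) d] by simp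
qed

text \<open>\<open>[a [^] Suc n, q]\<close> is a conjugate of \<open>[a, q]\<close> by
  \<open>a [^] n\<close> times \<open>[a [^] n, q]\<close>, and \<open>w a\<close> ignores that
  conjugation.\<close>

lemma w_commutator_pow:
  assumes a: "a \<in> M" and q: "q \<in> carrier G"
  shows "w a (commutator G (a [^] (n::nat)) q) = w a (commutator G a q) [^]\<^bsub>E\<^esub> n"
proof (induction n)
  case 0
  have "commutator G \<one> q = \<one>" using q by simp
  then show ?case using w_L_right[OF MN'[OF a] L.one_closed] by simp
next
  case (Suc n)
  let ?c = "commutator G a q" and ?b = "commutator G (a [^] n) q"
  have ac: "a \<in> carrier G" using a by simp
  have c: "?c \<in> M" "?b \<in> M" "a [^] n \<in> M" using a q M.commutator_mem pow_M by simp_all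
  have "commutator G (a [^] Suc n) q = conjg G (a [^] n) ?c \<otimes> ?b"
    using commutator_mult_left[of "a [^] n" a q] ac q by simp
  then have "w a (commutator G (a [^] Suc n) q) = w a ?c \<otimes>\<^bsub>E\<^esub> w a ?b"
    using w_mult_right[OF a M.conjg_mem[OF _ c(1)] c(2), of "a [^] n"] ac
      w_conjg_right[OF MN'[OF a] c(1,3)] by simp
  also have "\<dots> = w a ?c [^]\<^bsub>E\<^esub> Suc n"
    using Suc E.nat_pow_Suc2[of "w a ?c" n] MN'[OF a] ac q by simp
  finally show ?case .
qed

text \<open>In \<open>w_commute_mult\<close> with \<open>b = a [^] n\<close> the step contributes
  \<open>n\<close> further factors \<open>w a [a, q]\<close> by \<open>w_commutator_pow\<close>;
  these sum to \<open>n choose 2\<close>.\<close>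

lemma w_pow_left:
  assumes a: "a \<in> M" and q: "q \<in> carrier G"
  shows "w (a [^] (n::nat)) q
    = w a (commutator G a q) [^]\<^bsub>E\<^esub> (n choose 2) \<otimes>\<^bsub>E\<^esub> w a q [^]\<^bsub>E\<^esub> n"
proof (induction n)
  case 0
  then show ?case using w_one_left[OF q] by (simp add: numeral_2_eq_2)
next
  case (Suc n)
  let ?t = "w a (commutator G a q)" and ?u = "w a q"
  have aN: "a \<in> N" and ac: "a \<in> carrier G" using a MN' by simp_all
  have t: "?t \<in> carrier E" "?u \<in> carrier E" using aN ac q by simp_all
  have ch: "Suc n choose 2 = n + (n choose 2)" by (simp add: numeral_2_eq_2)
  have "w (a [^] Suc n) q = w a (commutator G (a [^] n) q) \<otimes>\<^bsub>E\<^esub> (w (a [^] n) q \<otimes>\<^bsub>E\<^esub> ?u)"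
    using w_commute_mult[OF MN'[OF pow_M[OF a]] aN q, of n] ac nat_pow_comm[of a n 1] by simp
  also have "\<dots> = ?t [^]\<^bsub>E\<^esub> n \<otimes>\<^bsub>E\<^esub> ((?t [^]\<^bsub>E\<^esub> (n choose 2) \<otimes>\<^bsub>E\<^esub> ?u [^]\<^bsub>E\<^esub> n) \<otimes>\<^bsub>E\<^esub> ?u)"
    unfolding w_commutator_pow[OF a q] Suc ..
  also have "\<dots> = (?t [^]\<^bsub>E\<^esub> n \<otimes>\<^bsub>E\<^esub> ?t [^]\<^bsub>E\<^esub> (n choose 2)) \<otimes>\<^bsub>E\<^esub> ?u [^]\<^bsub>E\<^esub> Suc n"
    using t by (simp add: E.m_assoc)
  finally show ?case using t by (simp add: ch E.nat_pow_mult)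
qed

text \<open>At \<open>n = p\<close> the left side of \<open>w_pow_left\<close> is trivial because
  \<open>a [^] p\<close> lies in \<open>L\<close>, and for odd \<open>p\<close> the exponent
  \<open>p choose 2\<close> is a multiple of \<open>p\<close>, which kills the first factor on the
  right.\<close>

lemma w_M_pow:
  assumes a: "a \<in> M" and q: "q \<in> carrier G"
  shows "w a q [^]\<^bsub>E\<^esub> p = \<one>\<^bsub>E\<^esub>"
proof -
  let ?t = "w a (commutator G a q)"
  have aN: "a \<in> N" and ac: "a \<in> carrier G" using a MN' by simp_all
  have t: "?t \<in> carrier E" using aN ac q by simp
  obtain k where k: "p = 2 * k + 1" using odd_p by (elim oddE)
  have "p choose 2 = p * k" by (simp add: k choose_two)
  moreover have "?t [^]\<^bsub>E\<^esub> p = \<one>\<^bsub>E\<^esub>" using w_MM_pow[OF a M.commutator_mem[OF a q]] .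
  ultimately have "?t [^]\<^bsub>E\<^esub> (p choose 2) = \<one>\<^bsub>E\<^esub>"
    using E.nat_pow_pow[OF t, of p k] by simp
  then show ?thesis using w_pow_left[OF a q, of p] w_L[OF pow_L[OF a] q] aN q by simp
qed

text \<open>By \<open>w_commutator\<close> the commutator of two generators is a value of
  \<open>w\<close> on \<open>M\<close> times \<open>M\<close>, hence commutes with every
  generator.\<close>

lemma generate_w_M_pow:
  assumes "x \<in> generate E {w m g | m g. m \<in> M \<and> g \<in> carrier G}"
  shows "x [^]\<^bsub>E\<^esub> p = \<one>\<^bsub>E\<^esub>"
proof (rule E.pow_generate_class2[OF _ odd_p _ _ assms])
  let ?S = "{w m g | m g. m \<in> M \<and> g \<in> carrier G}"
  show "?S \<subseteq> carrier E" using MN' by auto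
  show "s [^]\<^bsub>E\<^esub> p = \<one>\<^bsub>E\<^esub>" if "s \<in> ?S" for s using that w_M_pow by auto
  fix s t assume "s \<in> ?S" "t \<in> ?S"
  then obtain b h a q where s: "b \<in> M" "h \<in> carrier G" "s = w b h"
    and t: "a \<in> M" "q \<in> carrier G" "t = w a q" by auto
  let ?z = "w (commutator G b h) (commutator G a q)"
  have c: "commutator G b h \<in> M" "commutator G a q \<in> M" using s t M.commutator_mem by simp_all
  show "\<exists>z\<in>carrier E. s \<otimes>\<^bsub>E\<^esub> t = z \<otimes>\<^bsub>E\<^esub> (t \<otimes>\<^bsub>E\<^esub> s) \<and> (\<forall>u\<in>?S. z \<otimes>\<^bsub>E\<^esub> u = u \<otimes>\<^bsub>E\<^esub> z)"
  proof (intro bexI[of _ ?z] conjI ballI)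
    show "s \<otimes>\<^bsub>E\<^esub> t = ?z \<otimes>\<^bsub>E\<^esub> (t \<otimes>\<^bsub>E\<^esub> s)"
      using w_commutator[OF MN'[OF s(1)] s(2) MN'[OF t(1)] t(2)] s t by simp
    show "?z \<in> carrier E" using MN'[OF c(1)] M.mem_carrier[OF c(2)] by (rule w_closed)
    fix u assume "u \<in> ?S"
    then obtain n g where "n \<in> M" "g \<in> carrier G" "u = w n g" by auto
    then show "?z \<otimes>\<^bsub>E\<^esub> u = u \<otimes>\<^bsub>E\<^esub> ?z" using w_MM_central[OF c] by metis
  qed
qed

end

section \<open>Descent along the power series\<close>

lemma (in exterior_pairing) powerful_generate_pow:
  assumes p: "Factorial_Ring.prime (p::nat)" "odd p" and ord: "order G dvd p ^ k"
    and pow: "powerful G p N"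
    and gen: "carrier E = generate E {w n g | n g. n \<in> N \<and> g \<in> carrier G}"
    and x: "x \<in> carrier E"
  shows "x [^]\<^bsub>E\<^esub> (p ^ i) \<in> generate E {w m g | m g. m \<in> (pth_powers G p ^^ i) N \<and> g \<in> carrier G}"
proof (induction i)
  case 0
  then show ?case using x gen E.nat_pow_eone[OF x] by simp
next
  case (Suc i)
  define P where "P = (\<lambda>i. (pth_powers G p ^^ i) N)"
  have ser: "P i \<lhd> G" "P i \<subseteq> N" "\<lbrakk>g \<in> N; x \<in> P i\<rbrakk> \<Longrightarrow> commutator G g x \<in> P (Suc i)" for i g x
    unfolding P_def using powerful_series(1-3)[OF p ord normal_axioms pow] by blast+
  define K where "K = generate E {w m g | m g. m \<in> P (Suc i) \<and> g \<in> carrier G}"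
  have K: "K \<lhd> E" unfolding K_def by (rule w_normal[OF gen ser(1,2)])
  define y where "y = x [^]\<^bsub>E\<^esub> (p ^ i)"
  have y: "y \<in> generate E {w m g | m g. m \<in> P i \<and> g \<in> carrier G}"
    using Suc by (simp add: y_def P_def)
  have PS: "P (Suc i) = pth_powers G p (P i)" by (simp add: P_def)
  obtain Q :: "'c set monoid" and h where "group_hom E Q h" and "h ` carrier E = carrier Q"
    and h1: "\<And>x. x \<in> carrier E \<Longrightarrow> h x = \<one>\<^bsub>Q\<^esub> \<longleftrightarrow> x \<in> K" and "order Q dvd order E"
    using E.quotient_hom[OF K] by blast
  then interpret h: group_hom E Q h by simp
  \<comment> \<open>Passing to the quotient by \<open>K\<close> makes the pairing trivial on
    \<open>P (Suc i)\<close>; the remaining conditions come from \<open>powerful_series\<close> and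
    the definition of the series.\<close>
  interpret Q: exterior_pairing_layer N G Q "\<lambda>n g. h (w n g)" "P (Suc i)" "P i" p
  proof (intro exterior_pairing_layer.intro exterior_pairing_layer_axioms.intro)
    show "exterior_pairing N G Q (\<lambda>n g. h (w n g))"
      using h.group_hom_axioms by (rule hom_exterior_pairing)
    show "P (Suc i) \<lhd> G" "P i \<lhd> G" "P i \<subseteq> N" "odd p" using ser p by simp_all
    show "P (Suc i) \<subseteq> P i" unfolding PS by (intro pth_powers_subset normal_imp_subgroup ser)
    show "h (w l g) = \<one>\<^bsub>Q\<^esub>" if "l \<in> P (Suc i)" "g \<in> carrier G" for l g
    proof -
      have "w l g \<in> K" unfolding K_def using that by (intro generate.incl) blast
      moreover have "l \<in> N" using ser(2) that by blast
      ultimately show ?thesis using h1[of "w l g"] that by simp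
    qed
    show "commutator G x y \<in> P (Suc i)" if "x \<in> P i" "y \<in> P i" for x y
      using ser(3)[OF _ that(2)] ser(2) that(1) by blast
    show "x [^] p \<in> P (Suc i)" if "x \<in> P i" for x
      unfolding PS using that by (rule pth_powersI)
  qed
  have S: "{w m g | m g. m \<in> P i \<and> g \<in> carrier G} \<subseteq> carrier E" using ser(2)[of i] by auto
  have hS: "h ` {w m g | m g. m \<in> P i \<and> g \<in> carrier G} = {h (w m g) | m g. m \<in> P i \<and> g \<in> carrier G}"
    by blast
  have yc: "y \<in> carrier E" using x by (simp add: y_def)
  have "h y \<in> generate Q {h (w m g) | m g. m \<in> P i \<and> g \<in> carrier G}"
    using y h.generate_img[OF S] unfolding hS by blast
  then have "h y [^]\<^bsub>Q\<^esub> p = \<one>\<^bsub>Q\<^esub>" by (rule Q.generate_w_M_pow)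
  then have "h (y [^]\<^bsub>E\<^esub> p) = \<one>\<^bsub>Q\<^esub>" using h.hom_nat_pow[OF yc] by simp
  then have "y [^]\<^bsub>E\<^esub> p \<in> K" using h1[of "y [^]\<^bsub>E\<^esub> p"] yc by simp
  moreover have "y [^]\<^bsub>E\<^esub> p = x [^]\<^bsub>E\<^esub> (p ^ Suc i)"
    using x by (simp add: y_def E.nat_pow_pow mult.commute)
  ultimately show ?case by (simp add: K_def P_def)
qed

text \<open>The term of index \<open>e\<close> is generated by \<open>p ^ e\<close>-th powers and so
  is trivial; by \<open>w_one_left\<close> the subgroup reached after \<open>e\<close> steps is
  trivial as well.\<close>

lemma (in exterior_pairing) powerful_exponent:
  assumes p: "Factorial_Ring.prime (p::nat)" "odd p" and ord: "order G dvd p ^ k"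
    and pow: "powerful G p N"
    and gen: "carrier E = generate E {w n g | n g. n \<in> N \<and> g \<in> carrier G}"
    and exp: "\<And>n. n \<in> N \<Longrightarrow> n [^] (p ^ e) = \<one>"
    and x: "x \<in> carrier E"
  shows "x [^]\<^bsub>E\<^esub> (p ^ e) = \<one>\<^bsub>E\<^esub>"
proof -
  have "(pth_powers G p ^^ e) N \<subseteq> {\<one>}"
    using powerful_series(4)[OF p ord normal_axioms pow, of e] generate_powers_trivial[of N "p ^ e", OF exp]
    by simp
  then have "{w m g | m g. m \<in> (pth_powers G p ^^ e) N \<and> g \<in> carrier G} \<subseteq> {\<one>\<^bsub>E\<^esub>}"
    using w_one_left by auto
  then have "generate E {w m g | m g. m \<in> (pth_powers G p ^^ e) N \<and> g \<in> carrier G} \<subseteq> {\<one>\<^bsub>E\<^esub>}"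
    by (rule E.generate_subgroup_incl[OF _ E.triv_subgroup])
  then show ?thesis using powerful_generate_pow[OF p ord pow gen x, of e] by blast
qed

section \<open>The exterior product\<close>

context normal
begin

lemma ext_words_Nil [simp]: "[] \<in> ext_words G H"
  and ext_words_append [simp]: "u @ v \<in> ext_words G H \<longleftrightarrow> u \<in> ext_words G H \<and> v \<in> ext_words G H"
  and ext_words_Cons: "((n, g), b) # u \<in> ext_words G H \<longleftrightarrow> n \<in> H \<and> g \<in> carrier G \<and> u \<in> ext_words G H"
  by (auto simp: ext_words_def ext_letters_def)

text \<open>The defining relations introduce conjugated letters; normality of \<open>H\<close> keeps
  their first entries in \<open>H\<close>.\<close>

lemma ext_rel_words: "ext_rel G H u v \<Longrightarrow> u \<in> ext_words G H \<and> v \<in> ext_words G H"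
  by (induction rule: ext_rel.induct)
    (auto simp: ext_words_Cons conjg_def inv_op_closed2)

lemma ext_rel_append:
  assumes "ext_rel G H u u'" "ext_rel G H v v'"
  shows "ext_rel G H (u @ v) (u' @ v')"
proof -
  have "ext_rel G H ([] @ u @ v) ([] @ u' @ v)"
    using assms ext_rel_words by (intro ext_rel.ctx) auto
  moreover have "ext_rel G H (u' @ v @ []) (u' @ v' @ [])"
    using assms ext_rel_words by (intro ext_rel.ctx) auto
  ultimately show ?thesis using ext_rel.trans by force
qed

definition ext_class :: "(('a \<times> 'a) \<times> bool) list \<Rightarrow> (('a \<times> 'a) \<times> bool) list set" where
  "ext_class u = {v. ext_rel G H u v}"

lemma ext_class_eq_iff:
  assumes "u \<in> ext_words G H"
  shows "ext_class u = ext_class v \<longleftrightarrow> ext_rel G H u v"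
proof
  assume "ext_class u = ext_class v"
  moreover have "u \<in> ext_class u" using assms by (simp add: ext_class_def ext_rel.refl)
  ultimately show "ext_rel G H u v" unfolding ext_class_def by (blast intro: ext_rel.sym)
next
  assume "ext_rel G H u v"
  then show "ext_class u = ext_class v"
    unfolding ext_class_def by (blast intro: ext_rel.sym ext_rel.trans)
qed

lemma carrier_exterior_product: "carrier (exterior_product G H) = ext_class ` ext_words G H"
  by (auto simp: exterior_product_def ext_class_def)

lemma one_exterior_product: "\<one>\<^bsub>exterior_product G H\<^esub> = ext_class []"
  by (simp add: exterior_product_def ext_class_def)

lemma mult_exterior_product:
  assumes "u \<in> ext_words G H" "v \<in> ext_words G H"
  shows "ext_class u \<otimes>\<^bsub>exterior_product G H\<^esub> ext_class v = ext_class (u @ v)"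
proof -
  have "(\<exists>u'\<in>ext_class u. \<exists>v'\<in>ext_class v. ext_rel G H (u' @ v') w) \<longleftrightarrow> ext_rel G H (u @ v) w" for w
  proof
    assume "\<exists>u'\<in>ext_class u. \<exists>v'\<in>ext_class v. ext_rel G H (u' @ v') w"
    then show "ext_rel G H (u @ v) w"
      unfolding ext_class_def using ext_rel_append ext_rel.trans by blast
  next
    assume "ext_rel G H (u @ v) w"
    moreover have "u \<in> ext_class u" "v \<in> ext_class v" using assms by (simp_all add: ext_class_def ext_rel.refl)
    ultimately show "\<exists>u'\<in>ext_class u. \<exists>v'\<in>ext_class v. ext_rel G H (u' @ v') w" by blast
  qed
  then show ?thesis by (simp add: exterior_product_def ext_class_def)
qed

lemma ext_class_cancel:
  assumes "n \<in> H" "g \<in> carrier G"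
  shows "ext_class [((n, g), b), ((n, g), \<not> b)] = ext_class []"
  using assms ext_class_eq_iff[of "[((n, g), b), ((n, g), \<not> b)]" "[]"] ext_rel.cancel[of n H g G b]
  by (simp add: ext_words_Cons)

text \<open>The inverse word is built from the letters with flipped signs in reverse order: the
  flipped first letter of \<open>a # u\<close> goes to the end of the word for
  \<open>u\<close>.\<close>

lemma ext_class_inverse:
  assumes "u \<in> ext_words G H"
  shows "\<exists>v\<in>ext_words G H. ext_class (v @ u) = ext_class []"
  using assms
proof (induction u)
  case Nil
  then show ?case by (intro bexI[of _ "[]"]) simp_all
next
  case (Cons a u)
  obtain n g b where a: "a = ((n, g), b)" by (metis surj_pair)
  then have u: "n \<in> H" "g \<in> carrier G" "u \<in> ext_words G H" using Cons.prems by (simp_all add: ext_words_Cons)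
  obtain v where v: "v \<in> ext_words G H" "ext_class (v @ u) = ext_class []" using Cons.IH[OF u(3)] by auto
  have "ext_rel G H (v @ [((n, g), \<not> b), ((n, g), b)] @ u) (v @ [] @ u)"
    using ext_rel.cancel[of n H g G "\<not> b"] u v by (intro ext_rel.ctx) simp_all
  then have "ext_class ((v @ [((n, g), \<not> b)]) @ a # u) = ext_class (v @ u)"
    using u v by (subst ext_class_eq_iff) (simp_all add: a ext_words_Cons)
  then show ?case using u v by (intro bexI[of _ "v @ [((n, g), \<not> b)]"]) (simp_all add: ext_words_Cons)
qed

lemma group_exterior_product: "group (exterior_product G H)"
proof (rule groupI)
  fix x y z
  assume "x \<in> carrier (exterior_product G H)" "y \<in> carrier (exterior_product G H)"
    "z \<in> carrier (exterior_product G H)"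
  then obtain u v t where "u \<in> ext_words G H" "v \<in> ext_words G H" "t \<in> ext_words G H"
    "x = ext_class u" "y = ext_class v" "z = ext_class t"
    unfolding carrier_exterior_product by blast
  then show "x \<otimes>\<^bsub>exterior_product G H\<^esub> y \<otimes>\<^bsub>exterior_product G H\<^esub> z
      = x \<otimes>\<^bsub>exterior_product G H\<^esub> (y \<otimes>\<^bsub>exterior_product G H\<^esub> z)"
    by (simp add: mult_exterior_product)
next
  fix x assume "x \<in> carrier (exterior_product G H)"
  then obtain u where u: "u \<in> ext_words G H" "x = ext_class u"
    unfolding carrier_exterior_product by blast
  then show "\<one>\<^bsub>exterior_product G H\<^esub> \<otimes>\<^bsub>exterior_product G H\<^esub> x = x"
    by (simp add: mult_exterior_product one_exterior_product)
  obtain v where "v \<in> ext_words G H" "ext_class (v @ u) = ext_class []"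
    using ext_class_inverse[OF u(1)] by blast
  then show "\<exists>y\<in>carrier (exterior_product G H). y \<otimes>\<^bsub>exterior_product G H\<^esub> x = \<one>\<^bsub>exterior_product G H\<^esub>"
    using u unfolding carrier_exterior_product
    by (intro bexI[of _ "ext_class v"]) (simp_all add: mult_exterior_product one_exterior_product)
next
  fix x y assume "x \<in> carrier (exterior_product G H)" "y \<in> carrier (exterior_product G H)"
  then obtain u v where "u \<in> ext_words G H" "v \<in> ext_words G H" "x = ext_class u" "y = ext_class v"
    unfolding carrier_exterior_product by blast
  then show "x \<otimes>\<^bsub>exterior_product G H\<^esub> y \<in> carrier (exterior_product G H)"
    by (simp add: mult_exterior_product carrier_exterior_product)
qed (simp add: carrier_exterior_product one_exterior_product)

definition wedge :: "'a \<Rightarrow> 'a \<Rightarrow> (('a \<times> 'a) \<times> bool) list set" where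
  "wedge n g = ext_class [((n, g), True)]"

lemma wedge_pairing: "exterior_pairing H G (exterior_product G H) wedge"
proof -
  interpret X: group "exterior_product G H" by (rule group_exterior_product)
  note [simp] = ext_words_Cons conjg_mem mult_exterior_product one_exterior_product
  show ?thesis
  proof (unfold_locales, goal_cases)
    case (1 n g)
    then show ?case by (simp add: wedge_def carrier_exterior_product)
  next
    case (2 n n' g)
    then show ?case
      unfolding wedge_def by (simp add: ext_class_eq_iff ext_rel.rel_left)
  next
    case (3 n g g')
    then show ?case unfolding wedge_def by (simp add: ext_class_eq_iff ext_rel.rel_right)
  next
    case (4 x)
    then show ?case unfolding wedge_def by (simp add: ext_class_eq_iff ext_rel.rel_diag)
  qed
qed

lemma exterior_product_generated:
  "carrier (exterior_product G H)
    = generate (exterior_product G H) {wedge n g | n g. n \<in> H \<and> g \<in> carrier G}"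
    (is "_ = generate ?X ?S")
proof
  interpret X: exterior_pairing H G ?X wedge by (rule wedge_pairing)
  have S: "?S \<subseteq> carrier ?X" by auto
  show "generate ?X ?S \<subseteq> carrier ?X" using X.E.generate_in_carrier[OF S] by blast
  have "ext_class u \<in> generate ?X ?S" if "u \<in> ext_words G H" for u
    using that
  proof (induction u)
    case Nil
    then show ?case using generate.one[of ?X ?S] by (simp add: one_exterior_product)
  next
    case (Cons a u)
    obtain n g b where a: "a = ((n, g), b)" by (metis surj_pair)
    then have u: "n \<in> H" "g \<in> carrier G" "u \<in> ext_words G H"
      using Cons.prems by (simp_all add: ext_words_Cons)
    have w: "wedge n g \<in> ?S" using u by blast
    have aS: "ext_class [a] \<in> generate ?X ?S"
    proof (cases b)
      case True
      then show ?thesis using generate.incl[OF w] by (simp add: a wedge_def)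
    next
      case False
      \<comment> \<open>A letter with sign \<open>False\<close> represents the inverse of the
        generator \<open>wedge n g\<close>.\<close>
      have "ext_class [a] \<otimes>\<^bsub>?X\<^esub> wedge n g = \<one>\<^bsub>?X\<^esub>"
        using False u ext_class_cancel[OF u(1,2), of False]
        by (simp add: a wedge_def mult_exterior_product ext_words_Cons one_exterior_product)
      moreover have "ext_class [a] \<in> carrier ?X"
        using u unfolding carrier_exterior_product a by (intro imageI) (simp add: ext_words_Cons)
      ultimately have "inv\<^bsub>?X\<^esub> (wedge n g) = ext_class [a]"
        using S w by (intro X.E.inv_equality) blast+
      then show ?thesis using generate.inv[OF w, of ?X] by simp
    qed
    moreover have "ext_class (a # u) = ext_class [a] \<otimes>\<^bsub>?X\<^esub> ext_class u"
      using u by (simp add: a mult_exterior_product ext_words_Cons)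
    ultimately show ?case using generate.eng[OF aS Cons.IH[OF u(3)]] by simp
  qed
  then show "carrier ?X \<subseteq> generate ?X ?S" unfolding carrier_exterior_product by blast
qed

end

section \<open>Exponents and the conclusion\<close>

text \<open>The exponent \<open>n\<close> excludes the default value 0, so \<open>group_exp\<close>
  is the least positive exponent. The remainder of \<open>n\<close> modulo it would be a smaller one
  unless it is zero.\<close>

lemma group_exp_dvd:
  fixes K (structure)
  assumes "group K" and n: "n > 0" and pw: "\<And>x. x \<in> carrier K \<Longrightarrow> x [^]\<^bsub>K\<^esub> n = \<one>\<^bsub>K\<^esub>"
  shows "group_exp K dvd n"
    and "\<And>x. x \<in> carrier K \<Longrightarrow> x [^]\<^bsub>K\<^esub> group_exp K = \<one>\<^bsub>K\<^esub>"
proof -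
  interpret group K by fact
  define Pr where "Pr = (\<lambda>m::nat. m > 0 \<and> (\<forall>x\<in>carrier K. x [^] m = \<one>))"
  have Prn: "Pr n" using n pw by (simp add: Pr_def)
  have "\<exists>m::nat>0. \<forall>x\<in>carrier K. x [^] m = \<one>" using n pw by blast
  then have eq: "group_exp K = (LEAST m. Pr m)" unfolding group_exp_def Pr_def by (rule if_P)
  define m where "m = group_exp K"
  have Prm: "Pr m" unfolding m_def eq using Prn by (rule LeastI)
  then show "x [^] group_exp K = \<one>" if "x \<in> carrier K" for x
    using that by (simp add: Pr_def m_def)
  have "x [^] (n mod m) = \<one>" if x: "x \<in> carrier K" for x
  proof -
    have "\<one> = (x [^] m) [^] (n div m) \<otimes> x [^] (n mod m)"
      using x pw[OF x] nat_pow_mult[OF x, of "m * (n div m)" "n mod m"]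
      by (simp only: nat_pow_pow mult_div_mod_eq)
    moreover have "x [^] m = \<one>" using Prm x unfolding Pr_def by blast
    ultimately show ?thesis using x by simp
  qed
  then have "Pr (n mod m)" if "n mod m > 0" using that by (simp add: Pr_def)
  then have "m \<le> n mod m" if "n mod m > 0" using that unfolding m_def eq by (intro Least_le)
  moreover have "n mod m < m" using Prm by (simp add: Pr_def)
  ultimately have "n mod m = 0" by fastforce
  then show "group_exp K dvd n" by (simp add: m_def dvd_eq_mod_eq_0)
qed

theorem theorem4p5:
  fixes G :: "('a, 'b) monoid_scheme" and N :: "'a set" and p :: nat
  assumes "Factorial_Ring.prime p" and "odd p"
    and "p_group p G"
    and "N \<lhd> G"
    and "powerful G p N"
  shows "group_exp (exterior_product G N) dvd group_exp (G\<lparr>carrier := N\<rparr>)"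
proof -
  interpret normal N G by fact
  let ?X = "exterior_product G N" and ?N = "G\<lparr>carrier := N\<rparr>"
  interpret X: exterior_pairing N G ?X wedge by (rule wedge_pairing)
  interpret SN: group ?N by (rule subgroup_is_group[OF is_group])
  obtain k where k: "order G = p ^ k" using assms(3) by (auto simp: p_group_def order_def)
  have "card N dvd p ^ k" using lagrange[OF subgroup_axioms] k by (metis dvd_triv_right)
  then obtain j where j: "order ?N = p ^ j"
    using assms(1) divides_primepow_nat by (auto simp: order_def)
  have pos: "0 < p ^ i" for i using assms(1) prime_gt_0_nat by simp
  have pw: "x [^]\<^bsub>?N\<^esub> (p ^ j) = \<one>\<^bsub>?N\<^esub>" if "x \<in> carrier ?N" for x
    using SN.pow_order_eq_1[OF that] by (simp only: j)
  \<comment> \<open>The order of \<open>N\<close> annihilates \<open>N\<close>, so the exponent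
    divides a power of \<open>p\<close> and is itself one.\<close>
  obtain e where e: "group_exp ?N = p ^ e"
    using group_exp_dvd(1)[OF SN.is_group pos pw] assms(1) divides_primepow_nat by blast
  have "n [^]\<^bsub>G\<^esub> (p ^ e) = \<one>\<^bsub>G\<^esub>" if "n \<in> N" for n
    using group_exp_dvd(2)[OF SN.is_group pos pw, of n] that by (simp add: e nat_pow_consistent[symmetric])
  then have "x [^]\<^bsub>?X\<^esub> (p ^ e) = \<one>\<^bsub>?X\<^esub>" if "x \<in> carrier ?X" for x
    using X.powerful_exponent[OF assms(1,2) _ assms(5) exterior_product_generated _ that, of k e] k by simp
  then show ?thesis unfolding e using X.E.is_group pos by (intro group_exp_dvd(1))
qed

end
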